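(* Let $k\in\mathbb N\cup\{\infty\}$ with $k\ge2$, and let $\Theta\subseteq\Omega^{[\le k]}$ with $\Theta\neq\emptyset$. Assume that $k$ is the least element $\ell\in\mathbb N\cup\{\infty\}$ such that $\mathsf U^k_\Theta=\mathsf U^\ell_{\Theta'}$ for some $\Theta'\subseteq\Omega^{[\le\ell]}$. Let $C$ be a clone of Boolean functions. (i) $C\,\mathsf U^k_\Theta\subseteq\mathsf U^k_\Theta$ if and only if $C\subseteq\mathsf U^k$. (ii) If $\Theta$ is $(k,\Omega_{*1})$-closed, then (a) for $K=\mathsf U^k_\Theta\cap(\Omega_{01}\cup\mathsf C_0)$: $CK\subseteq K$ if and only if $C\subseteq\mathsf{MU}^k$; (b) for $K=\mathsf U^k_\Theta\cap\Omega_{01}$: $CK\subseteq K$ if and only if $C\subseteq\mathsf U^k_{01}$. (iii) If $\Theta$ is $(k,\Omega_{1*})$-closed, then (a) for $K=\mathsf U^k_\Theta\cap(\Omega_{10}\cup\mathsf C_0)$: $CK\subseteq K$ if and only if $C\subseteq\mathsf{MU}^k$; (b) for $K=\mathsf U^k_\Theta\cap\Omega_{10}$: $CK\subseteq K$ if and only if $C\subseteq\mathsf U^k_{01}$. (iv) If $\Theta$ is $(k,\mathsf M)$-closed, then (a) for $K=\mathsf U^k_\Theta\cap\mathsf M_{0*}$: $CK\subseteq K$ if and only if $C\subseteq\mathsf{MU}^k$; (b) for $K=\mathsf U^k_\Theta\cap\mathsf M_{01}$: $CK\subseteq K$ if and only if $C\subseteq\mathsf{MU}^k_{01}$. (v)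 If $\Theta$ is $(k,\overline{\mathsf M})$-closed, then (a) for $K=\mathsf U^k_\Theta\cap\overline{\mathsf M}_{*0}$: $CK\subseteq K$ if and only if $C\subseteq\mathsf{MU}^k$; (b) for $K=\mathsf U^k_\Theta\cap\overline{\mathsf M}_{10}$: $CK\subseteq K$ if and only if $C\subseteq\mathsf{MU}^k_{01}$. (vi) If $\Theta$ is $(k,\mathsf R)$-closed, then for $K=\mathsf U^k_\Theta\cap\mathsf R_{00}$: $CK\subseteq K$ if and only if $C\subseteq\mathsf U^k$.
   Context: Boolean functions: maps $f:\{0,1\}^n\to\{0,1\}$ with $n\ge1$; $\Omega$ is the set of all of them. $\mathbf 0,\mathbf 1$ denote constant tuples, tuples are ordered componentwise, $\overline{\mathbf a}$ is the componentwise complement, $[n]=\{1,\dots,n\}$. For $I,J\subseteq\Omega$, $IJ$ is the set of all compositions $f(g_1,\dots,g_n)$ with $f\in I$ $n$-ary and $g_1,\dots,g_n\in J$ of a common arity, where $f(g_1,\dots,g_n)(\mathbf a)=f(g_1(\mathbf a),\dots,g_n(\mathbf a))$. A clone is a set $C\subseteq\Omega$ that contains all projections and satisfies $CC\subseteq C$. Classes: $\mathsf M$ = monotone functions; $\overline{\mathsf M}$ = negations $1-f$ of monotone $f$; $\mathsf R$ = functions with $f(\mathbf a)=f(\overline{\mathbf a})$ for all $\mathbf a$; $\mathsf C_0$ = constant $0$ functions (all arities). For $X\subseteq\Omega$ and $a,b\in\{0,1\}$: $X_{a*}=\{f\in X: f(\mathbf 0)=a\}$, $X_{*b}=\{f\in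 X: f(\mathbf 1)=b\}$, $X_{ab}=X_{a*}\cap X_{*b}$. $\mathsf U^k$ (no lower index) is the clone of all $f\in\Omega$ such that $\bigwedge T\neq\mathbf 0$ for every $T\subseteq f^{-1}(1)$ with $|T|\le k$; $\mathsf U^k_{01}=(\mathsf U^k)_{01}$, $\mathsf{MU}^k=\mathsf M\cap\mathsf U^k$, $\mathsf{MU}^k_{01}=(\mathsf{MU}^k)_{01}$. For $g$ $m$-ary and $\sigma:[m]\to[n]$, let $g_\sigma(a_1,\dots,a_n)=g(a_{\sigma(1)},\dots,a_{\sigma(m)})$; the functions $g_\sigma$ are the minors of $g$. $f$ is a minorant of $g$ (same arity) if $f(\mathbf a)\le g(\mathbf a)$ for all $\mathbf a$. $\sqsubseteq$ is the transitive closure of the union of the relations "is a minorant of" and "is a minor of" on $\Omega$; $\downarrow X=\{f:\exists x\in X,\ f\sqsubseteq x\}$. For $T\subseteq\{0,1\}^n$, $\chi_T$ is the $n$-ary function with $\chi_T^{-1}(1)=T$. For $\ell\in\mathbb N\cup\{\infty\}$ ($0\in\mathbb N$) and $\Theta\subseteq\Omega$: $\Omega^{[\le\ell]}=\{f\in\Omega:|f^{-1}(1)|\le\ell\}$, and $\mathsf U^\ell_\Theta$ (lower index a set of functions) is the set of all $f\in\Omega$ such that $\chi_T\in\downarrow\Theta$ for every $T\subseteq f^{-1}(1)$ with $|T|\le\ell$. For $\mathcal C\in\{\Omega_{*1},\Omega_{1*},\mathsf M,\overline{\mathsf M},\mathsf R\}$, $f^{\mathcal C}$ is the least majorant of $f$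 (pointwise order, same arity) lying in $\mathcal C$ (it exists). A set $\Phi\subseteq\Omega$ is $(k,\mathcal C)$-closed if for every $\varphi\in\Phi$ and every $T\subseteq(\varphi^{\mathcal C})^{-1}(1)$ with $|T|\le k$ we have $\chi_T\in\Phi$. *)

theory Defs
  imports Main "HOL-Library.Extended_Nat"
begin

text \<open>
  An \<open>n\<close>-ary Boolean function is a pair of its arity and a predicate on \<open>bool list\<close>, where lists of
  length \<open>n\<close> represent the tuples in \<open>{0,1}\<^sup>n\<close>. The predicate is required to be false on
  lists of any other length, so that equality of pairs is equality of Boolean functions.
  Coordinates are numbered \<open>0, \<dots>, n - 1\<close>.
\<close>

type_synonym bfun = "nat \<times> (bool list \<Rightarrow> bool)"

abbreviation arity :: "bfun \<Rightarrow> nat" where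
  "arity f \<equiv> fst f"

abbreviation app :: "bfun \<Rightarrow> bool list \<Rightarrow> bool" where
  "app f a \<equiv> snd f a"

definition Omega :: "bfun set" where
  "Omega = {f. 1 \<le> arity f \<and> (\<forall>a. app f a \<longrightarrow> length a = arity f)}"

definition mk :: "nat \<Rightarrow> (bool list \<Rightarrow> bool) \<Rightarrow> bfun" where
  "mk n p = (n, \<lambda>a. length a = n \<and> p a)"

definition ones :: "bfun \<Rightarrow> bool list set" where
  "ones f = {a. length a = arity f \<and> app f a}"

definition chi :: "nat \<Rightarrow> bool list set \<Rightarrow> bfun" where
  "chi n T = mk n (\<lambda>a. a \<in> T)"

definition tuple_le :: "bool list \<Rightarrow> bool list \<Rightarrow> bool" where
  "tuple_le a b \<longleftrightarrow> list_all2 (\<le>) a b"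

definition tuple_meet :: "nat \<Rightarrow> bool list set \<Rightarrow> bool list" where
  "tuple_meet n T = map (\<lambda>i. \<forall>a\<in>T. a ! i) [0..<n]"


definition compose :: "nat \<Rightarrow> bfun \<Rightarrow> bfun list \<Rightarrow> bfun" where
  "compose m f gs = mk m (\<lambda>a. app f (map (\<lambda>g. app g a) gs))"

definition set_compose :: "bfun set \<Rightarrow> bfun set \<Rightarrow> bfun set" where
  "set_compose I J =
     {compose m f gs | m f gs. f \<in> I \<and> length gs = arity f \<and> set gs \<subseteq> J \<and> (\<forall>g\<in>set gs. arity g = m)}"

definition projection :: "nat \<Rightarrow> nat \<Rightarrow> bfun" where
  "projection n i = mk n (\<lambda>a. a ! i)"

definition clone :: "bfun set \<Rightarrow> bool" where
  "clone C \<longleftrightarrow> C \<subseteq> Omega \<and> (\<forall>n i. i < n \<longrightarrow> projection n i \<in> C) \<and> set_compose C C \<subseteq> C"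


definition Mon :: "bfun set" where
  "Mon = {f \<in> Omega. \<forall>a b. length a = arity f \<and> length b = arity f \<and> tuple_le a b \<longrightarrow> app f a \<le> app f b}"

definition neg :: "bfun \<Rightarrow> bfun" where
  "neg f = mk (arity f) (\<lambda>a. \<not> app f a)"

definition NegMon :: "bfun set" where
  "NegMon = neg ` Mon"

definition Reflexive :: "bfun set" where
  "Reflexive = {f \<in> Omega. \<forall>a. length a = arity f \<longrightarrow> app f a = app f (map Not a)}"

definition Const0 :: "bfun set" where
  "Const0 = {f \<in> Omega. \<forall>a. length a = arity f \<longrightarrow> \<not> app f a}"

definition at_zero :: "bfun set \<Rightarrow> bool \<Rightarrow> bfun set" where
  "at_zero X c = {f \<in> X. app f (replicate (arity f) False) = c}"

definition at_one :: "bfun set \<Rightarrow> bool \<Rightarrow> bfun set" where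
  "at_one X d = {f \<in> X. app f (replicate (arity f) True) = d}"

definition at_both :: "bfun set \<Rightarrow> bool \<Rightarrow> bool \<Rightarrow> bfun set" where
  "at_both X c d = at_zero X c \<inter> at_one X d"

text \<open>
  The sets \<open>T\<close> below are sets of tuples of a fixed length, hence finite, so \<open>card\<close> is their true size.
\<close>

definition U :: "enat \<Rightarrow> bfun set" where
  "U k = {f \<in> Omega. \<forall>T. T \<subseteq> ones f \<and> enat (card T) \<le> k \<longrightarrow>
            tuple_meet (arity f) T \<noteq> replicate (arity f) False}"

definition MU :: "enat \<Rightarrow> bfun set" where
  "MU k = Mon \<inter> U k"


definition minorant :: "bfun \<Rightarrow> bfun \<Rightarrow> bool" where
  "minorant f g \<longleftrightarrow> f \<in> Omega \<and> g \<in> Omega \<and> arity f = arity g \<and>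
     (\<forall>a. length a = arity f \<longrightarrow> app f a \<le> app g a)"

definition minor_map :: "nat \<Rightarrow> (nat \<Rightarrow> nat) \<Rightarrow> bfun \<Rightarrow> bfun" where
  "minor_map n \<sigma> g = mk n (\<lambda>a. app g (map (\<lambda>i. a ! \<sigma> i) [0..<arity g]))"

definition minor :: "bfun \<Rightarrow> bfun \<Rightarrow> bool" where
  "minor f g \<longleftrightarrow> f \<in> Omega \<and> g \<in> Omega \<and>
     (\<exists>n \<sigma>. (\<forall>i<arity g. \<sigma> i < n) \<and> f = minor_map n \<sigma> g)"

definition below :: "bfun \<Rightarrow> bfun \<Rightarrow> bool" where
  "below = (\<lambda>f g. minorant f g \<or> minor f g)\<^sup>+\<^sup>+"

definition down :: "bfun set \<Rightarrow> bfun set" where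
  "down X = {f. \<exists>x\<in>X. below f x}"

definition Omega_le :: "enat \<Rightarrow> bfun set" where
  "Omega_le l = {f \<in> Omega. enat (card (ones f)) \<le> l}"

definition U_sub :: "enat \<Rightarrow> bfun set \<Rightarrow> bfun set" where
  "U_sub l \<Theta> = {f \<in> Omega. \<forall>T. T \<subseteq> ones f \<and> enat (card T) \<le> l \<longrightarrow> chi (arity f) T \<in> down \<Theta>}"


definition is_least_majorant :: "bfun set \<Rightarrow> bfun \<Rightarrow> bfun \<Rightarrow> bool" where
  "is_least_majorant X f h \<longleftrightarrow>
     h \<in> X \<and> minorant f h \<and> (\<forall>g\<in>X. minorant f g \<longrightarrow> minorant h g)"

definition least_majorant :: "bfun set \<Rightarrow> bfun \<Rightarrow> bfun" where
  "least_majorant X f = (THE h. is_least_majorant X f h)"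

definition closed_under :: "enat \<Rightarrow> bfun set \<Rightarrow> bfun set \<Rightarrow> bool" where
  "closed_under k X \<Phi> \<longleftrightarrow>
     (\<forall>\<phi>\<in>\<Phi>. \<forall>T. T \<subseteq> ones (least_majorant X \<phi>) \<and> enat (card T) \<le> k \<longrightarrow> chi (arity \<phi>) T \<in> \<Phi>)"


text \<open>
  The definite description in \<^const>\<open>least_majorant\<close> is well defined for the five classes it is
  applied to.
\<close>

lemma minorant_antisym:
  assumes "minorant f g" "minorant g f"
  shows "f = g"
proof (rule prod_eqI)
  show ar: "arity f = arity g" using assms(1) by (simp add: minorant_def)
  show "snd f = snd g"
  proof
    fix a
    show "app f a = app g a"
    proof (cases "length a = arity f")
      case True
      then have "app f a \<le> app g a" "app g a \<le> app f a"
        using assms unfolding minorant_def by metis+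
      then show ?thesis by (rule order_antisym)
    next
      case False
      moreover have "f \<in> Omega" "g \<in> Omega"
        using assms(1) by (simp_all add: minorant_def)
      ultimately show ?thesis
        using ar unfolding Omega_def mem_Collect_eq by auto
    qed
  qed
qed

lemma is_least_majorant_unique:
  "is_least_majorant X f h \<Longrightarrow> is_least_majorant X f h' \<Longrightarrow> h = h'"
  by (meson is_least_majorant_def minorant_antisym)

lemma is_least_majorant_least_majorant:
  "is_least_majorant X f h \<Longrightarrow> is_least_majorant X f (least_majorant X f)"
  unfolding least_majorant_def
  by (rule theI) (assumption, rule is_least_majorant_unique)

definition meet_majorants :: "bfun set \<Rightarrow> bfun \<Rightarrow> bfun" where
  "meet_majorants X f = mk (arity f) (\<lambda>a. \<forall>g\<in>X. minorant f g \<longrightarrow> app g a)"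

lemma meet_majorants_Omega: "f \<in> Omega \<Longrightarrow> meet_majorants X f \<in> Omega"
  by (simp add: meet_majorants_def mk_def Omega_def)

lemma arity_meet_majorants: "arity (meet_majorants X f) = arity f"
  by (simp add: meet_majorants_def mk_def)

lemma app_meet_majorants:
  "length a = arity f \<Longrightarrow> app (meet_majorants X f) a \<longleftrightarrow> (\<forall>g\<in>X. minorant f g \<longrightarrow> app g a)"
  by (simp add: meet_majorants_def mk_def)

lemma is_least_majorant_meet:
  assumes "f \<in> Omega" "meet_majorants X f \<in> X"
  shows "is_least_majorant X f (meet_majorants X f)"
  unfolding is_least_majorant_def
proof (intro conjI ballI impI)
  note Om = meet_majorants_Omega[OF assms(1), of X] and ar = arity_meet_majorants[of X f]
  show "meet_majorants X f \<in> X" by (rule assms(2))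
  show "minorant f (meet_majorants X f)"
    unfolding minorant_def
  proof (intro conjI allI impI assms(1) Om ar[symmetric])
    fix a :: "bool list" assume a: "length a = arity f"
    show "app f a \<le> app (meet_majorants X f) a"
      unfolding app_meet_majorants[OF a] using a by (auto simp: minorant_def)
  qed
  fix g assume g: "g \<in> X" "minorant f g"
  show "minorant (meet_majorants X f) g"
    unfolding minorant_def ar
  proof (intro conjI allI impI Om)
    show "g \<in> Omega" "arity f = arity g"
      using g(2) unfolding minorant_def by blast+
    fix a :: "bool list" assume a: "length a = arity f"
    show "app (meet_majorants X f) a \<le> app g a"
      unfolding app_meet_majorants[OF a] using g by (intro le_boolI) blast
  qed
qed

lemma neg_Omega: "f \<in> Omega \<Longrightarrow> neg f \<in> Omega"
  by (simp add: neg_def mk_def Omega_def)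

lemma arity_neg: "arity (neg f) = arity f"
  by (simp add: neg_def mk_def)

lemma app_neg: "length a = arity f \<Longrightarrow> app (neg f) a \<longleftrightarrow> \<not> app f a"
  by (simp add: neg_def mk_def)

lemma neg_neg: "f \<in> Omega \<Longrightarrow> neg (neg f) = f"
  by (rule prod_eqI) (auto simp: neg_def mk_def Omega_def)

lemma MonD:
  assumes "f \<in> Mon" "length a = arity f" "length b = arity f" "tuple_le a b" "app f a"
  shows "app f b"
proof -
  have "app f a \<le> app f b"
    using assms(1) conjI[OF assms(2) conjI[OF assms(3,4)]] unfolding Mon_def mem_Collect_eq
    by (elim conjE allE impE) (intro conjI)
  then show ?thesis using assms(5) by (simp add: le_bool_def)
qed

lemma NegMonD:
  assumes "f \<in> NegMon" "length a = arity f" "length b = arity f" "tuple_le a b" "app f b"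
  shows "app f a"
proof -
  obtain h where "h \<in> Mon" "f = neg h" using assms(1) by (auto simp: NegMon_def)
  then have ar: "arity h = arity f" by (simp add: arity_neg)
  have la: "length a = arity h" and lb: "length b = arity h"
    using assms(2,3) ar by simp_all
  have "\<not> app h b"
    using assms(5) \<open>f = neg h\<close> app_neg[OF lb] by simp
  then have "\<not> app h a"
    using MonD[OF \<open>h \<in> Mon\<close> la lb assms(4)] by blast
  then show ?thesis
    using \<open>f = neg h\<close> app_neg[OF la] by simp
qed

lemma NegMonI:
  assumes "f \<in> Omega"
    and "\<And>a b. length a = arity f \<Longrightarrow> length b = arity f \<Longrightarrow> tuple_le a b \<Longrightarrow> app f b \<Longrightarrow> app f a"
  shows "f \<in> NegMon"
proof -
  have "app (neg f) a \<le> app (neg f) b"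
    if "length a = arity f" "length b = arity f" "tuple_le a b" for a b
    unfolding app_neg[OF that(1)] app_neg[OF that(2)] using assms(2)[OF that] by (intro le_boolI) blast
  then have "neg f \<in> Mon"
    using neg_Omega[OF assms(1)] unfolding Mon_def mem_Collect_eq arity_neg by blast
  then show ?thesis
    unfolding NegMon_def using neg_neg[OF assms(1)] by (metis imageI)
qed

lemma meet_majorants_classes:
  assumes "f \<in> Omega"
    and "X \<in> {at_one Omega True, at_zero Omega True, Mon, NegMon, Reflexive}"
  shows "meet_majorants X f \<in> X"
proof -
  let ?h = "meet_majorants X f"
  have Om: "?h \<in> Omega" by (rule meet_majorants_Omega[OF assms(1)])
  have ar: "arity ?h = arity f" by (rule arity_meet_majorants)
  have ar': "arity g = arity f" if "minorant f g" for g
    using that by (simp add: minorant_def)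
  have hI: "app ?h a"
    if "length a = arity f" "\<And>g. g \<in> X \<Longrightarrow> minorant f g \<Longrightarrow> arity g = arity f \<Longrightarrow> app g a" for a
    unfolding app_meet_majorants[OF that(1)] using that(2) ar' by blast
  have hD: "app g a"
    if "app ?h a" "length a = arity f" "g \<in> X" "minorant f g" for a g
    using that(1,3,4) unfolding app_meet_majorants[OF that(2)] by blast
  from assms(2) consider "X = at_one Omega True" | "X = at_zero Omega True" | "X = Mon"
    | "X = NegMon" | "X = Reflexive"
    by blast
  then show ?thesis
  proof cases
    case 1
    have "app ?h (replicate (arity f) True)"
    proof (rule hI)
      fix g assume "g \<in> X" "arity g = arity f"
      then show "app g (replicate (arity f) True)" unfolding 1 at_one_def by simp
    qed simp
    then have "?h \<in> at_one Omega True" using Om by (simp add: at_one_def ar)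
    then show ?thesis using 1 by simp
  next
    case 2
    have "app ?h (replicate (arity f) False)"
    proof (rule hI)
      fix g assume "g \<in> X" "arity g = arity f"
      then show "app g (replicate (arity f) False)" unfolding 2 at_zero_def by simp
    qed simp
    then have "?h \<in> at_zero Omega True" using Om by (simp add: at_zero_def ar)
    then show ?thesis using 2 by simp
  next
    case 3
    have "app ?h a \<le> app ?h b"
      if l: "length a = arity f" "length b = arity f" "tuple_le a b" for a b
    proof (rule le_boolI, rule hI[OF l(2)])
      fix g assume "app ?h a" "g \<in> X" "minorant f g" "arity g = arity f"
      then show "app g b" using hD[of a g] MonD[of g a b] l 3 by simp
    qed
    then have "?h \<in> Mon" using Om unfolding Mon_def mem_Collect_eq ar by blast
    then show ?thesis using 3 by simp
  next
    case 4
    have "?h \<in> NegMon"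
    proof (rule NegMonI[OF Om])
      fix a b
      assume l: "length a = arity ?h" "length b = arity ?h" "tuple_le a b" "app ?h b"
      show "app ?h a"
      proof (rule hI)
        show "length a = arity f" using l(1) ar by simp
        fix g assume "g \<in> X" "minorant f g" "arity g = arity f"
        then show "app g a" using hD[of b g] NegMonD[of g a b] l ar 4 by simp
      qed
    qed
    then show ?thesis using 4 by simp
  next
    case 5
    have R: "app g a = app g (map Not a)" if "g \<in> X" "length a = arity g" for g a
      using that unfolding 5 Reflexive_def by blast
    have "app ?h a = app ?h (map Not a)" if l: "length a = arity f" for a
    proof -
      have l': "length (map Not a) = arity f" using l by simp
      show ?thesis
        unfolding app_meet_majorants[OF l] app_meet_majorants[OF l']
        using R l ar' by metis
    qed
    then have "?h \<in> Reflexive" using Om unfolding Reflexive_def mem_Collect_eq ar by blast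
    then show ?thesis using 5 by simp
  qed
qed

lemma least_majorant_classes:
  assumes "f \<in> Omega"
    and "X \<in> {at_one Omega True, at_zero Omega True, Mon, NegMon, Reflexive}"
  shows "is_least_majorant X f (least_majorant X f)"
  by (rule is_least_majorant_least_majorant[OF is_least_majorant_meet[OF assms(1) meet_majorants_classes[OF assms]]])

end

theory Submission
  imports Defs
begin

text \<open>
  If \<open>C K \<subseteq> K\<close>, then every function in \<open>C\<close> preserves each relation \<open>{(h(a))\<^sub>a | h \<in> K}\<close>, where \<open>a\<close>
  runs over a fixed set of tuples. Conversely, a composition \<open>f(g\<^sub>1, \<dots>, g\<^sub>n)\<close> with \<open>f \<in> U k\<close> and
  \<open>g\<^sub>i \<in> U_sub k \<Theta>\<close> is in \<open>U_sub k \<Theta>\<close>, because at most \<open>k\<close> ones of it are ones of a single \<open>g\<^sub>i\<close>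
  (\<open>compose_U_sub\<close>). So each equivalence comes down to finding enough functions in \<open>K\<close>.

  These functions are built from critical sets: sets \<open>S\<close> of at most \<open>k\<close> tuples with
  \<open>\<chi>\<^sub>S \<notin> \<down>\<Theta>\<close> all of whose proper subsets \<open>A\<close> satisfy \<open>\<chi>\<^sub>A \<in> \<down>\<Theta>\<close>. Minimality of \<open>k\<close>
  yields critical sets with at least \<open>p\<close> elements for every finite \<open>p \<le> k\<close> (\<open>ex_large_critical\<close>).
  Suppose \<open>f \<in> C\<close> takes the value \<open>1\<close> on a set \<open>T\<close> of at most \<open>k\<close> tuples with meet \<open>0\<close>. Choose a critical \<open>S\<close> with at least as
  many elements and a surjection \<open>\<pi>\<close> from \<open>S\<close> to \<open>T\<close>. The set \<open>S\<^sub>i\<close> on which the \<open>i\<close>-th coordinate of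
  \<open>\<pi>\<close> is \<open>1\<close> is a proper subset of \<open>S\<close>, so \<open>\<chi>\<^sub>S\<^sub>i\<close> is admissible as \<open>g\<^sub>i\<close>; but \<open>f(g\<^sub>1, \<dots>, g\<^sub>n)\<close> is
  \<open>1\<close> on \<open>S\<close>. Hence \<open>C \<subseteq> U k\<close> (\<open>stabilizer_subset_U\<close>).

  In the presence of one of the classes \<open>X\<close>, the function \<open>\<chi>\<^sub>S\<^sub>i\<close> is replaced by its least majorant
  in \<open>X\<close>. Since \<open>X\<close> is closed under minors, the closure hypothesis on \<open>\<Theta>\<close> passes to \<open>\<down>\<Theta>\<close>
  (\<open>hull_closed_of_closed_under\<close>), so the majorant stays in \<open>U_sub k \<Theta>\<close>; and it adds no element of
  the critical set (\<open>hull_inter_critical\<close>), so the argument above is undisturbed. Moreover the closure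
  hypothesis forces \<open>U_sub k \<Theta>\<close> to vanish at one or both constant tuples: otherwise
  \<open>\<down>\<Theta>\<close> would contain the characteristic function of the set of both constant tuples, and with it every
  \<open>\<chi>\<^sub>S\<close>, so that there would be no critical set (\<open>not_down_const\<close>).
  That is why prescribing the value \<open>0\<close> there imposes no condition.

  The remaining conditions are read off at one or two tuples: a constant tuple at which all of \<open>K\<close> is
  \<open>1\<close> yields \<open>f(1, \<dots>, 1) = 1\<close> (\<open>stabilizer_const_True\<close>), and two tuples at which the values of \<open>K\<close>
  form the order relation yield monotonicity (\<open>stabilizer_monotone\<close>).
\<close>


section \<open>Tuples, minors and the quasi-order\<close>

abbreviation cube :: "nat \<Rightarrow> bool list set" where
  "cube n \<equiv> {a. length a = n}"

lemma finite_cube: "finite (cube n)"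
  using finite_lists_length_eq[of "UNIV :: bool set" n] by simp

definition reindex :: "nat \<Rightarrow> (nat \<Rightarrow> nat) \<Rightarrow> bool list \<Rightarrow> bool list" where
  "reindex l \<sigma> a = map (\<lambda>i. a ! \<sigma> i) [0..<l]"

lemma length_reindex [simp]: "length (reindex l \<sigma> a) = l"
  by (simp add: reindex_def)

lemma reindex_reindex:
  assumes "\<And>i. i < l \<Longrightarrow> \<tau> i < m"
  shows "reindex l \<tau> (reindex m \<sigma> a) = reindex l (\<sigma> \<circ> \<tau>) a"
  using assms by (simp add: reindex_def)

lemma reindex_replicate:
  assumes "\<And>i. i < l \<Longrightarrow> \<sigma> i < n"
  shows "reindex l \<sigma> (replicate n c) = replicate l c"
  using assms by (intro nth_equalityI) (auto simp: reindex_def)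

lemma reindex_const: "reindex l (\<lambda>_. i) a = replicate l (a ! i)"
  by (intro nth_equalityI) (auto simp: reindex_def)

lemma minor_map_simps:
  "arity (minor_map n \<sigma> g) = n"
  "app (minor_map n \<sigma> g) a \<longleftrightarrow> length a = n \<and> app g (reindex (arity g) \<sigma> a)"
  by (simp_all add: minor_map_def mk_def reindex_def)

lemma Omega_minor_map: "1 \<le> n \<Longrightarrow> minor_map n \<sigma> g \<in> Omega"
  by (simp add: minor_map_def mk_def Omega_def)

lemma chi_simps [simp]:
  "arity (chi n T) = n"
  "app (chi n T) a \<longleftrightarrow> length a = n \<and> a \<in> T"
  by (simp_all add: chi_def mk_def)

lemma chi_in_Omega [simp]: "chi n T \<in> Omega \<longleftrightarrow> 1 \<le> n"
  by (auto simp: Omega_def)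

lemma ones_chi: "ones (chi n T) = T \<inter> cube n"
  by (auto simp: ones_def)

lemma OmegaD: "f \<in> Omega \<Longrightarrow> 1 \<le> arity f" "f \<in> Omega \<Longrightarrow> app f a \<Longrightarrow> length a = arity f"
  by (auto simp: Omega_def)

lemma ones_subset_cube: "ones f \<subseteq> cube (arity f)"
  by (auto simp: ones_def)

text \<open>Since a minor of a minorant of \<open>g\<close> is a minorant of a minor of \<open>g\<close>, every chain of the two
  relations collapses to one substitution of variables followed by one comparison.\<close>

lemma below_iff:
  "below f g \<longleftrightarrow> f \<in> Omega \<and> g \<in> Omega \<and>
     (\<exists>\<sigma>. (\<forall>i<arity g. \<sigma> i < arity f) \<and> (\<forall>a. app f a \<longrightarrow> app g (reindex (arity g) \<sigma> a)))"
  (is "_ \<longleftrightarrow> ?R f g")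
proof
  have step: "?R f g" if "minorant f g \<or> minor f g" for f g
    using that
  proof
    assume m: "minorant f g"
    have "reindex (arity g) (\<lambda>i. i) a = a" if "length a = arity g" for a
      using that by (intro nth_equalityI) (auto simp: reindex_def)
    with m show "?R f g"
      by (intro conjI exI[of _ "\<lambda>i. i"]) (auto simp: minorant_def le_bool_def dest: OmegaD(2))
  next
    assume "minor f g"
    then show "?R f g"
      unfolding minor_def by (elim conjE exE) (rule conjI exI | assumption | simp add: minor_map_simps)+
  qed
  assume "below f g"
  then show "?R f g"
    unfolding below_def
  proof (induction rule: tranclp_induct)
    case (base y)
    then show ?case by (rule step)
  next
    case (step y z)
    from step.IH obtain \<sigma> where s: "\<forall>i<arity y. \<sigma> i < arity f"
      "\<forall>a. app f a \<longrightarrow> app y (reindex (arity y) \<sigma> a)" by blast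
    from \<open>minorant y z \<or> minor y z\<close> have "?R y z" by (rule \<open>\<And>f g. minorant f g \<or> minor f g \<Longrightarrow> ?R f g\<close>)
    then obtain \<tau> where t: "\<forall>i<arity z. \<tau> i < arity y"
      "\<forall>a. app y a \<longrightarrow> app z (reindex (arity z) \<tau> a)" by blast
    have "\<forall>a. app f a \<longrightarrow> app z (reindex (arity z) (\<sigma> \<circ> \<tau>) a)"
      using s(2) t reindex_reindex[of "arity z" \<tau> "arity y" \<sigma>] by metis
    moreover have "\<forall>i<arity z. (\<sigma> \<circ> \<tau>) i < arity f" using s(1) t(1) by simp
    ultimately show ?case using step.IH \<open>?R y z\<close> by blast
  qed
next
  assume "?R f g"
  then obtain \<sigma> where s: "f \<in> Omega" "g \<in> Omega" "\<forall>i<arity g. \<sigma> i < arity f"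
      "\<forall>a. app f a \<longrightarrow> app g (reindex (arity g) \<sigma> a)" by blast
  let ?h = "minor_map (arity f) \<sigma> g"
  have h: "?h \<in> Omega" using s(1) by (intro Omega_minor_map OmegaD)
  have "minorant f ?h"
    using s h by (auto simp: minorant_def minor_map_simps le_bool_def)
  moreover have "minor ?h g"
    using s h unfolding minor_def by blast
  ultimately show "below f g"
    unfolding below_def
    by (intro tranclp.trancl_into_trancl[OF tranclp.r_into_trancl, of _ f ?h g]) simp_all
qed

lemma chi_in_down_iff:
  assumes "\<Theta> \<subseteq> Omega" "1 \<le> n" "A \<subseteq> cube n"
  shows "chi n A \<in> down \<Theta> \<longleftrightarrow>
    (\<exists>\<theta>\<in>\<Theta>. \<exists>\<sigma>. (\<forall>i<arity \<theta>. \<sigma> i < n) \<and> (\<forall>a\<in>A. app \<theta> (reindex (arity \<theta>) \<sigma> a)))"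
proof -
  have "app (chi n A) a \<longleftrightarrow> a \<in> A" for a using assms(3) by auto
  then have "below (chi n A) \<theta> \<longleftrightarrow>
      (\<exists>\<sigma>. (\<forall>i<arity \<theta>. \<sigma> i < n) \<and> (\<forall>a\<in>A. app \<theta> (reindex (arity \<theta>) \<sigma> a)))" if "\<theta> \<in> \<Theta>" for \<theta>
    unfolding below_iff Ball_def using assms(1,2) that by auto
  then show ?thesis by (auto simp: down_def)
qed

lemma chi_reindex_down:
  assumes "\<Theta> \<subseteq> Omega" "chi m B \<in> down \<Theta>" "1 \<le> m" "B \<subseteq> cube m"
    and "1 \<le> n" "A \<subseteq> cube n" "\<And>i. i < m \<Longrightarrow> \<tau> i < n" "\<And>a. a \<in> A \<Longrightarrow> reindex m \<tau> a \<in> B"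
  shows "chi n A \<in> down \<Theta>"
proof -
  obtain \<theta> \<sigma> where t: "\<theta> \<in> \<Theta>" "\<forall>i<arity \<theta>. \<sigma> i < m" "\<forall>b\<in>B. app \<theta> (reindex (arity \<theta>) \<sigma> b)"
    using assms(2) chi_in_down_iff[OF assms(1,3,4)] by blast
  have "app \<theta> (reindex (arity \<theta>) (\<tau> \<circ> \<sigma>) a)" if "a \<in> A" for a
    using t assms(8)[OF that] reindex_reindex[of "arity \<theta>" \<sigma> m \<tau> a] by metis
  then show ?thesis
    unfolding chi_in_down_iff[OF assms(1,5,6)]
    using t assms(7) by (intro bexI[of _ \<theta>] exI[of _ "\<tau> \<circ> \<sigma>"]) auto
qed

lemma chi_subset_down:
  assumes "\<Theta> \<subseteq> Omega" "chi n B \<in> down \<Theta>" "1 \<le> n" "B \<subseteq> cube n" "A \<subseteq> B"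
  shows "chi n A \<in> down \<Theta>"
proof -
  have A: "A \<subseteq> cube n" using assms(4,5) by blast
  show ?thesis
    using assms(2,5) unfolding chi_in_down_iff[OF assms(1,3,4)] chi_in_down_iff[OF assms(1,3) A] by blast
qed

lemma down_trans: "x \<in> down X \<Longrightarrow> X \<subseteq> down Y \<Longrightarrow> x \<in> down Y"
  unfolding down_def below_def by (blast intro: tranclp_trans)

lemma down_refl: "X \<subseteq> Omega \<Longrightarrow> X \<subseteq> down X"
  by (auto simp: down_def below_def minorant_def)

lemma U_subD:
  assumes "f \<in> U_sub k \<Theta>" "T \<subseteq> ones f" "enat (card T) \<le> k"
  shows "chi (arity f) T \<in> down \<Theta>"
  using assms by (simp add: U_sub_def)


section \<open>Hulls\<close>

definition class_hull :: "bfun set \<Rightarrow> nat \<Rightarrow> bool list set \<Rightarrow> bool list set" where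
  "class_hull X n A = {a \<in> cube n. \<forall>g\<in>X. arity g = n \<and> (\<forall>b\<in>A. app g b) \<longrightarrow> app g a}"

definition hull_class :: "bfun set \<Rightarrow> bool" where
  "hull_class X \<longleftrightarrow> (\<forall>n A. 1 \<le> n \<longrightarrow> A \<subseteq> cube n \<longrightarrow> chi n (class_hull X n A) \<in> X)"

text \<open>The closure condition on \<open>\<Theta>\<close>, transferred to the set \<open>\<down>\<Theta>\<close> on which \<^term>\<open>U_sub k \<Theta>\<close> depends.
  In this form it holds for every set \<open>\<Theta>\<close> of Boolean functions when \<open>X\<close> is the class of all functions.\<close>

definition hull_closed :: "enat \<Rightarrow> bfun set \<Rightarrow> bfun set \<Rightarrow> bool" where
  "hull_closed k X \<Theta> \<longleftrightarrow> (\<forall>n A T. 1 \<le> n \<longrightarrow> A \<subseteq> cube n \<longrightarrow> chi n A \<in> down \<Theta> \<longrightarrow>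
     T \<subseteq> class_hull X n A \<longrightarrow> enat (card T) \<le> k \<longrightarrow> chi n T \<in> down \<Theta>)"

lemma hull_closedD:
  assumes "hull_closed k X \<Theta>" "1 \<le> n" "A \<subseteq> cube n" "chi n A \<in> down \<Theta>"
    and "T \<subseteq> class_hull X n A" "enat (card T) \<le> k"
  shows "chi n T \<in> down \<Theta>"
  using assms by (simp add: hull_closed_def)

lemma hull_subset_cube: "class_hull X n A \<subseteq> cube n"
  by (auto simp: class_hull_def)

lemma subset_hull: "A \<subseteq> cube n \<Longrightarrow> A \<subseteq> class_hull X n A"
  by (auto simp: class_hull_def)

lemma hull_least: "g \<in> X \<Longrightarrow> arity g = n \<Longrightarrow> (\<And>b. b \<in> A \<Longrightarrow> app g b) \<Longrightarrow> a \<in> class_hull X n A \<Longrightarrow> app g a"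
  by (auto simp: class_hull_def)

lemma hull_mono: "A \<subseteq> B \<Longrightarrow> class_hull X n A \<subseteq> class_hull X n B"
  unfolding class_hull_def by blast

lemma hull_class_inter:
  assumes "hull_class X" "hull_class Y"
  shows "hull_class (X \<inter> Y)"
  unfolding hull_class_def
proof (intro allI impI)
  fix n :: nat and A assume n: "1 \<le> n" "A \<subseteq> cube n"
  let ?H = "class_hull (X \<inter> Y) n A"
  have "class_hull Z n ?H = ?H" if "X \<inter> Y \<subseteq> Z" for Z
  proof
    show "class_hull Z n ?H \<subseteq> ?H" using that unfolding class_hull_def by blast
  qed (rule subset_hull[OF hull_subset_cube])
  then have "class_hull X n ?H = ?H" "class_hull Y n ?H = ?H" by simp_all
  then show "chi n ?H \<in> X \<inter> Y"
    using assms n(1) hull_subset_cube[of "X \<inter> Y" n A] unfolding hull_class_def by (metis IntI)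
qed

text \<open>The hull of \<open>A\<close> is the set of ones of the meet of all majorants of \<open>\<chi>\<^sub>A\<close> in \<open>X\<close>.\<close>

lemma hull_class_of_meet:
  assumes "X \<subseteq> Omega" "\<And>f. f \<in> Omega \<Longrightarrow> meet_majorants X f \<in> X"
  shows "hull_class X"
  unfolding hull_class_def
proof (intro allI impI)
  fix n :: nat and A assume n: "1 \<le> n" "A \<subseteq> cube n"
  have "minorant (chi n A) g \<longleftrightarrow> arity g = n \<and> (\<forall>b\<in>A. app g b)" if "g \<in> X" for g
    using that n assms(1) by (auto simp: minorant_def le_bool_def)
  then have "meet_majorants X (chi n A) = chi n (class_hull X n A)"
    unfolding meet_majorants_def chi_def mk_def class_hull_def by auto
  then show "chi n (class_hull X n A) \<in> X"
    using assms(2)[of "chi n A"] n by simp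
qed

text \<open>The witness \<open>(\<theta>, \<sigma>)\<close> for \<open>\<chi>\<^sub>A \<in> \<down>\<Theta>\<close> also serves the hull of \<open>A\<close>: if \<open>h\<close> is the least
  majorant of \<open>\<theta>\<close> in \<open>X\<close>, then the minor of \<open>h\<close> along \<open>\<sigma>\<close> lies in \<open>X\<close> and contains \<open>A\<close>, hence
  contains the hull, so that \<open>\<sigma>\<close> sends small subsets of the hull to small subsets of
  \<open>h\<^sup>-\<^sup>1(1)\<close>, which belong to \<open>\<Theta>\<close>.\<close>

lemma hull_closed_of_closed_under:
  assumes "\<Theta> \<subseteq> Omega" "closed_under k X \<Theta>"
    and lm: "\<And>\<theta>. \<theta> \<in> \<Theta> \<Longrightarrow> is_least_majorant X \<theta> (least_majorant X \<theta>)"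
    and minors: "\<And>g n \<sigma>. g \<in> X \<Longrightarrow> 1 \<le> n \<Longrightarrow> \<forall>i<arity g. \<sigma> i < n \<Longrightarrow> minor_map n \<sigma> g \<in> X"
  shows "hull_closed k X \<Theta>"
  unfolding hull_closed_def
proof (intro allI impI)
  fix n :: nat and A T
  assume n: "1 \<le> n" "A \<subseteq> cube n" "chi n A \<in> down \<Theta>" and T: "T \<subseteq> class_hull X n A" "enat (card T) \<le> k"
  obtain \<theta> \<sigma> where t: "\<theta> \<in> \<Theta>" "\<forall>i<arity \<theta>. \<sigma> i < n" "\<forall>b\<in>A. app \<theta> (reindex (arity \<theta>) \<sigma> b)"
    using n(3) chi_in_down_iff[OF assms(1) n(1,2)] by blast
  define h where "h = least_majorant X \<theta>"
  have h: "h \<in> X" "minorant \<theta> h"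
    using lm[OF t(1)] by (auto simp: h_def is_least_majorant_def)
  then have ar: "arity h = arity \<theta>" by (simp add: minorant_def)
  have "minor_map n \<sigma> h \<in> X" using minors h(1) n(1) t(2) ar by simp
  moreover have "app (minor_map n \<sigma> h) b" if "b \<in> A" for b
    using t(3) h(2) n(2) that by (auto simp: minor_map_simps ar minorant_def le_bool_def)
  ultimately have "app (minor_map n \<sigma> h) a" if "a \<in> class_hull X n A" for a
    using hull_least[of "minor_map n \<sigma> h" X n A a] that by (simp add: minor_map_simps)
  then have im: "reindex (arity \<theta>) \<sigma> ` T \<subseteq> ones h"
    using T(1) by (auto simp: minor_map_simps ones_def ar)
  have Tn: "T \<subseteq> cube n" using T(1) hull_subset_cube by blast
  then have "card (reindex (arity \<theta>) \<sigma> ` T) \<le> card T"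
    by (intro card_image_le finite_subset[OF _ finite_cube])
  then have "enat (card (reindex (arity \<theta>) \<sigma> ` T)) \<le> k"
    using T(2) by (meson enat_ord_simps(1) order_trans)
  then have "chi (arity \<theta>) (reindex (arity \<theta>) \<sigma> ` T) \<in> \<Theta>"
    using assms(2) t(1) im unfolding closed_under_def h_def by blast
  then show "chi n T \<in> down \<Theta>"
    unfolding chi_in_down_iff[OF assms(1) n(1) Tn]
    by (rule bexI[rotated]) (use t(2) in \<open>auto intro!: exI[of _ \<sigma>]\<close>)
qed


section \<open>Critical sets\<close>

definition critical :: "enat \<Rightarrow> bfun set \<Rightarrow> nat \<Rightarrow> bool list set \<Rightarrow> bool" where
  "critical k \<Theta> n S \<longleftrightarrow> 1 \<le> n \<and> S \<subseteq> cube n \<and> enat (card S) \<le> k \<and>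
     chi n S \<notin> down \<Theta> \<and> (\<forall>A. A \<subset> S \<longrightarrow> chi n A \<in> down \<Theta>)"

text \<open>If every critical set had at most \<open>l < k\<close> elements, then membership in \<open>U_sub k \<Theta>\<close> could be
  tested on subsets of size at most \<open>l\<close>, contrary to the choice of \<open>k\<close>.\<close>

lemma ex_large_critical:
  assumes "\<Theta> \<subseteq> Omega"
    and min: "\<And>l. l < k \<Longrightarrow> \<not> (\<exists>\<Theta>'. \<Theta>' \<subseteq> Omega_le l \<and> U_sub k \<Theta> = U_sub l \<Theta>')"
    and "enat l < k"
  shows "\<exists>n S. critical k \<Theta> n S \<and> l < card S"
proof -
  define \<Theta>' where "\<Theta>' = down \<Theta> \<inter> Omega_le (enat l)"
  have le: "\<Theta>' \<subseteq> Omega_le (enat l)" by (simp add: \<Theta>'_def)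
  have sub: "U_sub k \<Theta> \<subseteq> U_sub (enat l) \<Theta>'"
  proof
    fix f assume f: "f \<in> U_sub k \<Theta>"
    then have Om: "f \<in> Omega" by (simp add: U_sub_def)
    have "chi (arity f) T \<in> down \<Theta>'" if T: "T \<subseteq> ones f" "enat (card T) \<le> enat l" for T
    proof -
      have "enat (card T) \<le> k" using T(2) assms(3) by order
      then have "chi (arity f) T \<in> down \<Theta>" using U_subD[OF f T(1)] by blast
      moreover have "T \<inter> cube (arity f) = T" using T(1) ones_subset_cube by blast
      then have "chi (arity f) T \<in> Omega_le (enat l)"
        using T(2) OmegaD(1)[OF Om] by (simp add: Omega_le_def ones_chi)
      ultimately have "chi (arity f) T \<in> \<Theta>'" by (simp add: \<Theta>'_def)
      moreover have "\<Theta>' \<subseteq> Omega" using le by (auto simp: Omega_le_def)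
      ultimately show ?thesis using down_refl by blast
    qed
    with Om show "f \<in> U_sub (enat l) \<Theta>'" by (simp add: U_sub_def)
  qed
  have "U_sub k \<Theta> \<noteq> U_sub (enat l) \<Theta>'" using min[OF assms(3)] le by blast
  with sub obtain f where f: "f \<in> U_sub (enat l) \<Theta>'" "f \<notin> U_sub k \<Theta>" by blast
  then have Om: "f \<in> Omega" by (simp add: U_sub_def)
  with f(2) obtain T where T: "T \<subseteq> ones f" "enat (card T) \<le> k" "chi (arity f) T \<notin> down \<Theta>"
    by (auto simp: U_sub_def)
  have fin: "finite T" using T(1) ones_subset_cube finite_cube by (meson finite_subset)
  define F where "F = {S. S \<subseteq> T \<and> chi (arity f) S \<notin> down \<Theta>}"
  have "finite F" "F \<noteq> {}" using fin T(3) by (auto simp: F_def)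
  then obtain S where S: "S \<in> F" "\<And>A. A \<in> F \<Longrightarrow> A \<subseteq> S \<Longrightarrow> A = S"
    using finite_has_minimal[of F] by metis
  have ST: "S \<subseteq> T" "chi (arity f) S \<notin> down \<Theta>" using S(1) by (auto simp: F_def)
  have "card S \<le> card T" using ST(1) fin by (rule card_mono[rotated])
  then have "enat (card S) \<le> k" using T(2) by (meson enat_ord_simps(1) order_trans)
  moreover have "S \<subseteq> cube (arity f)" using ST(1) T(1) ones_subset_cube by blast
  moreover have "chi (arity f) A \<in> down \<Theta>" if "A \<subset> S" for A
    using S(2)[of A] that ST(1) by (auto simp: F_def)
  ultimately have "critical k \<Theta> (arity f) S"
    using ST(2) OmegaD(1)[OF Om] by (simp add: critical_def)
  moreover have "l < card S"
  proof (rule ccontr)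
    assume "\<not> l < card S"
    then have "chi (arity f) S \<in> down \<Theta>'" using U_subD[OF f(1)] ST(1) T(1) by auto
    then have "chi (arity f) S \<in> down \<Theta>" by (rule down_trans) (simp add: \<Theta>'_def)
    with ST(2) show False by blast
  qed
  ultimately show ?thesis by blast
qed

text \<open>The existence of critical sets as large as \<open>k\<close> permits is the form in which the minimality of
  \<open>k\<close> enters the computation of the stabilizers.\<close>

locale large_critical_sets =
  fixes k :: enat and \<Theta> :: "bfun set"
  assumes k2: "2 \<le> k"
    and Theta_Omega: "\<Theta> \<subseteq> Omega"
    and ex_critical: "\<And>l. enat l < k \<Longrightarrow> \<exists>n S. critical k \<Theta> n S \<and> l < card S"
begin

lemma small_le_k: "n \<le> 2 \<Longrightarrow> enat n \<le> k"
  using k2 by (metis enat_ord_simps(1) numeral_eq_enat order_trans)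

lemma ex_critical_ge:
  assumes "enat p \<le> k"
  shows "\<exists>n S. critical k \<Theta> n S \<and> p \<le> card S \<and> 2 \<le> card S"
proof -
  define q where "q = max p 2"
  have q: "enat q \<le> k" using assms small_le_k[of 2] by (simp add: q_def max_def)
  have "enat (q - 1) < enat q" by (simp add: q_def)
  then have "enat (q - 1) < k" using q by order
  then obtain n S where "critical k \<Theta> n S" "q - 1 < card S" using ex_critical by blast
  then show ?thesis by (intro exI[of _ n] exI[of _ S]) (auto simp: q_def)
qed

lemma hull_in_U_sub:
  assumes "hull_closed k X \<Theta>" "1 \<le> n" "A \<subseteq> cube n" "chi n A \<in> down \<Theta>"
  shows "chi n (class_hull X n A) \<in> U_sub k \<Theta>"
  using assms by (auto simp: U_sub_def ones_chi hull_closed_def)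

text \<open>If the hull of a proper subset \<open>A\<close> of \<open>S\<close> met \<open>S - A\<close> in \<open>s\<close>, then \<open>S\<close> would lie in the hull of
  \<open>S - {s}\<close>, and \<open>\<chi>\<^sub>S\<close> would be in \<open>\<down>\<Theta>\<close>.\<close>

lemma hull_inter_critical:
  assumes "hull_closed k X \<Theta>" "critical k \<Theta> n S" "A \<subset> S"
  shows "class_hull X n A \<inter> S \<subseteq> A"
proof (rule ccontr)
  assume "\<not> class_hull X n A \<inter> S \<subseteq> A"
  then obtain s where s: "s \<in> class_hull X n A" "s \<in> S" "s \<notin> A" by blast
  let ?B = "S - {s}"
  have S: "1 \<le> n" "S \<subseteq> cube n" "enat (card S) \<le> k" "chi n S \<notin> down \<Theta>" "chi n ?B \<in> down \<Theta>"
    using assms(2) s(2) by (auto simp: critical_def)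
  have "A \<subseteq> ?B" using assms(3) s(3) by blast
  then have "s \<in> class_hull X n ?B" using hull_mono s(1) by blast
  moreover have "?B \<subseteq> class_hull X n ?B" using S(2) by (intro subset_hull) blast
  ultimately have "S \<subseteq> class_hull X n ?B" by blast
  then have "chi n S \<in> down \<Theta>"
    using assms(1) S unfolding hull_closed_def by blast
  with S(4) show False ..
qed

text \<open>Substituting one and the same variable for all variables turns every tuple into a constant one.
  So if \<open>\<down>\<Theta>\<close> contained the characteristic function of the set of both constant tuples, it would
  contain every \<open>\<chi>\<^sub>S\<close>, and no set could be critical.\<close>

lemma not_down_const:
  assumes "hull_closed k X \<Theta>" "1 \<le> n"
    and h: "replicate n e \<in> class_hull X n {replicate n (\<not> e)}"
  shows "chi n {replicate n (\<not> e)} \<notin> down \<Theta>"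
proof
  assume d: "chi n {replicate n (\<not> e)} \<in> down \<Theta>"
  let ?T = "{replicate n (\<not> e), replicate n e}"
  have "?T \<subseteq> class_hull X n {replicate n (\<not> e)}"
    using h subset_hull[of "{replicate n (\<not> e)}" n X] by simp
  moreover have "enat (card ?T) \<le> k" by (intro small_le_k) (simp add: card_insert_if)
  ultimately have T: "chi n ?T \<in> down \<Theta>"
    using hull_closedD[OF assms(1,2) _ d] by simp
  obtain m S where S: "critical k \<Theta> m S"
    using ex_critical_ge[of 0] small_le_k[of 0] by auto
  have "reindex n (\<lambda>_. 0) a \<in> ?T" for a
    unfolding reindex_const by (cases "a ! 0"; cases e) auto
  then have "chi m S \<in> down \<Theta>"
    using S by (intro chi_reindex_down[OF Theta_Omega T assms(2), of m S "\<lambda>_. 0"]) (auto simp: critical_def)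
  with S show False by (simp add: critical_def)
qed

lemma U_sub_const_False:
  assumes "hull_closed k X \<Theta>" and "\<And>n. 1 \<le> n \<Longrightarrow> replicate n e \<in> class_hull X n {replicate n (\<not> e)}"
    and g: "g \<in> U_sub k \<Theta>"
  shows "\<not> app g (replicate (arity g) (\<not> e))"
proof
  assume a: "app g (replicate (arity g) (\<not> e))"
  have n: "1 \<le> arity g" using g OmegaD(1) by (simp add: U_sub_def)
  have "chi (arity g) {replicate (arity g) (\<not> e)} \<in> down \<Theta>"
    by (rule U_subD[OF g]) (use a in \<open>auto simp: ones_def intro: small_le_k\<close>)
  with not_down_const[OF assms(1) n assms(2)[OF n]] show False ..
qed

end


section \<open>What a stabilizer preserves\<close>

lemma compose_simps:
  "arity (compose m f gs) = m"
  "app (compose m f gs) a \<longleftrightarrow> length a = m \<and> app f (map (\<lambda>g. app g a) gs)"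
  by (simp_all add: compose_def mk_def)

lemma set_composeI:
  assumes "f \<in> C" "length gs = arity f" "set gs \<subseteq> K" "\<And>g. g \<in> set gs \<Longrightarrow> arity g = m"
  shows "compose m f gs \<in> set_compose C K"
  using assms unfolding set_compose_def by blast

lemma set_compose_subset_iff:
  "set_compose C K \<subseteq> K' \<longleftrightarrow> (\<forall>m f gs. f \<in> C \<longrightarrow> length gs = arity f \<longrightarrow> set gs \<subseteq> K \<longrightarrow>
     (\<forall>g\<in>set gs. arity g = m) \<longrightarrow> compose m f gs \<in> K')"
  by (auto simp: set_compose_def)

lemma set_compose_mono: "K \<subseteq> K' \<Longrightarrow> set_compose C K \<subseteq> set_compose C K'"
  unfolding set_compose_def by blast

lemma U_const_False:
  assumes "1 \<le> k" "f \<in> U k"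
  shows "\<not> app f (replicate (arity f) False)"
proof
  let ?z = "replicate (arity f) False"
  assume "app f ?z"
  then have "{?z} \<subseteq> ones f" by (simp add: ones_def)
  moreover have "enat (card {?z}) \<le> k" using assms(1) by (simp add: one_enat_def)
  moreover have "tuple_meet (arity f) {?z} = ?z"
    by (intro nth_equalityI) (auto simp: tuple_meet_def)
  ultimately show False using assms(2) unfolding U_def by blast
qed

text \<open>A set of at most \<open>k\<close> ones of \<open>f(g\<^sub>1, \<dots>, g\<^sub>n)\<close> is mapped by \<open>(g\<^sub>1, \<dots>, g\<^sub>n)\<close> to at most \<open>k\<close>
  ones of \<open>f\<close>; a coordinate \<open>i\<close> on which these are all \<open>1\<close> makes it a set of ones of \<open>g\<^sub>i\<close>.\<close>

lemma compose_U_sub: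
  assumes f: "f \<in> U k" and gs: "length gs = arity f" "set gs \<subseteq> U_sub k \<Theta>" "\<forall>g\<in>set gs. arity g = m"
  shows "compose m f gs \<in> U_sub k \<Theta>"
proof -
  have fO: "f \<in> Omega" using f by (simp add: U_def)
  then have "gs \<noteq> []" using gs(1) OmegaD(1)[OF fO] by auto
  then have g0: "hd gs \<in> set gs" by simp
  then have "hd gs \<in> Omega" "arity (hd gs) = m" using gs(2,3) by (auto simp: U_sub_def)
  then have m: "1 \<le> m" using OmegaD(1) by blast
  let ?h = "compose m f gs"
  have "chi m T \<in> down \<Theta>" if T: "T \<subseteq> ones ?h" "enat (card T) \<le> k" for T
  proof -
    let ?v = "\<lambda>a. map (\<lambda>g. app g a) gs"
    have Tm: "T \<subseteq> cube m" using T(1) by (auto simp: ones_def compose_simps)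
    then have "card (?v ` T) \<le> card T"
      by (intro card_image_le finite_subset[OF _ finite_cube])
    then have "enat (card (?v ` T)) \<le> k" using T(2) by (meson enat_ord_simps(1) order_trans)
    moreover have "?v ` T \<subseteq> ones f"
      using T(1) gs(1) by (auto simp: ones_def compose_simps)
    ultimately have "tuple_meet (arity f) (?v ` T) \<noteq> replicate (arity f) False"
      using f unfolding U_def by blast
    then obtain i where i: "i < arity f" "\<forall>a\<in>T. ?v a ! i"
      by (force simp: tuple_meet_def list_eq_iff_nth_eq)
    let ?g = "gs ! i"
    have g: "?g \<in> set gs" using i(1) gs(1) by simp
    then have "T \<subseteq> ones ?g" using i gs(1,3) Tm by (auto simp: ones_def)
    then show ?thesis using U_subD[of ?g k \<Theta> T] T(2) g gs(2,3) by auto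
  qed
  then show ?thesis using m by (simp add: U_sub_def compose_simps compose_def mk_def Omega_def)
qed

text \<open>Here the pairs \<open>(h x, h y)\<close> with \<open>h \<in> K\<close> are exactly the three pairs of the order relation on
  \<open>{0, 1}\<close>, so functions that stabilize \<open>K\<close> preserve the order.\<close>

lemma stabilizer_monotone:
  assumes C: "C \<subseteq> Omega" and st: "set_compose C K \<subseteq> K"
    and len: "length x = m" "length y = m"
    and G0: "G0 \<in> K" "arity G0 = m" "\<not> app G0 x" "\<not> app G0 y"
    and G1: "G1 \<in> K" "arity G1 = m" "\<not> app G1 x" "app G1 y"
    and G2: "G2 \<in> K" "arity G2 = m" "app G2 x" "app G2 y"
    and le: "\<And>h. h \<in> K \<Longrightarrow> arity h = m \<Longrightarrow> app h x \<Longrightarrow> app h y"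
  shows "C \<subseteq> Mon"
proof
  fix f assume f: "f \<in> C"
  then have fO: "f \<in> Omega" using C by blast
  have "app f b" if ab: "length a = arity f" "length b = arity f" "tuple_le a b" "app f a" for a b
  proof -
    define gs where "gs = map (\<lambda>i. if a ! i then G2 else if b ! i then G1 else G0) [0..<arity f]"
    have gs: "length gs = arity f" "set gs \<subseteq> K" "\<And>g. g \<in> set gs \<Longrightarrow> arity g = m"
      using G0 G1 G2 by (auto simp: gs_def)
    have mono: "a ! i \<Longrightarrow> b ! i" if "i < arity f" for i
      using ab(1,3) that by (auto simp: tuple_le_def list_all2_conv_all_nth)
    have vx: "map (\<lambda>g. app g x) gs = a"
      using ab(1) G0 G1 G2 by (intro nth_equalityI) (auto simp: gs_def)
    have vy: "map (\<lambda>g. app g y) gs = b"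
      using ab(2) mono G0 G1 G2 by (intro nth_equalityI) (auto simp: gs_def)
    let ?h = "compose m f gs"
    have "?h \<in> K" using st set_composeI[OF f gs] by blast
    moreover have "app ?h x" using ab(4) len vx by (simp add: compose_simps)
    ultimately have "app ?h y" using le[of ?h] compose_simps(1) by blast
    then show "app f b" using vy by (simp add: compose_simps)
  qed
  then show "f \<in> Mon" using fO unfolding Mon_def by (auto simp: le_bool_def)
qed

lemma stabilizer_const_True:
  assumes st: "set_compose C K \<subseteq> K" and g: "g \<in> K"
    and K: "\<And>h. h \<in> K \<Longrightarrow> app h (replicate (arity h) e)"
    and f: "f \<in> C"
  shows "app f (replicate (arity f) True)"
proof -
  let ?h = "compose (arity g) f (replicate (arity f) g)"
  have "?h \<in> K"
    by (intro subsetD[OF st] set_composeI[OF f]) (use g in auto)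
  from K[OF this] show ?thesis using K[OF g] by (simp add: compose_simps)
qed

context large_critical_sets
begin

text \<open>A function of \<open>C\<close> outside \<open>U k\<close> would compose hulls of proper subsets of a critical set \<open>S\<close> to
  a function that is \<open>1\<close> on all of \<open>S\<close>.\<close>

lemma stabilizer_subset_U:
  assumes C: "C \<subseteq> Omega" and X: "hull_class X" "hull_closed k X \<Theta>"
    and st: "set_compose C (U_sub k \<Theta> \<inter> X) \<subseteq> U_sub k \<Theta>"
  shows "C \<subseteq> U k"
proof (rule subsetI, rule ccontr)
  fix f assume f: "f \<in> C" and "f \<notin> U k"
  then obtain T where T: "T \<subseteq> ones f" "enat (card T) \<le> k"
      "tuple_meet (arity f) T = replicate (arity f) False"
    using C by (auto simp: U_def)
  have ar: "1 \<le> arity f" using f C OmegaD(1) by blast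
  have fin: "finite T" using T(1) ones_subset_cube finite_cube by (meson finite_subset)
  have meet: "\<exists>t\<in>T. \<not> t ! i" if "i < arity f" for i
    using arg_cong[OF T(3), of "\<lambda>l. l ! i"] that by (simp add: tuple_meet_def)
  then obtain t0 where t0: "t0 \<in> T" using ar by (metis less_le_trans zero_less_one)
  obtain n S where S: "critical k \<Theta> n S" "card T \<le> card S"
    using ex_critical_ge[OF T(2)] by blast
  have Sn: "1 \<le> n" "S \<subseteq> cube n" using S(1) by (auto simp: critical_def)
  have finS: "finite S" using Sn(2) finite_cube finite_subset by blast
  obtain \<iota> where \<iota>: "\<iota> ` T \<subseteq> S" "inj_on \<iota> T" using card_le_inj[OF fin finS S(2)] by blast
  \<comment> \<open>\<open>\<pi>\<close> maps \<open>S\<close> onto \<open>T\<close>, inverting \<open>\<iota>\<close>.\<close>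
  define \<pi> where "\<pi> s = (if s \<in> \<iota> ` T then inv_into T \<iota> s else t0)" for s
  have \<pi>T: "\<pi> s \<in> T" for s by (auto simp: \<pi>_def t0 inv_into_into)
  have \<pi>S: "\<exists>s\<in>S. \<pi> s = t" if "t \<in> T" for t
    using that \<iota> by (intro bexI[of _ "\<iota> t"]) (auto simp: \<pi>_def)
  define A where "A i = {s \<in> S. \<pi> s ! i}" for i
  \<comment> \<open>The meet of \<open>T\<close> is \<open>0\<close>, so some \<open>t \<in> T\<close> has a \<open>0\<close> at position \<open>i\<close>.\<close>
  have A: "A i \<subset> S" if "i < arity f" for i
  proof -
    from meet[OF that] obtain t where "t \<in> T" "\<not> t ! i" ..
    moreover from this(1) obtain s where "s \<in> S" "\<pi> s = t" using \<pi>S by blast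
    ultimately show ?thesis by (auto simp: A_def)
  qed
  define g where "g i = chi n (class_hull X n (A i))" for i
  have gK: "g i \<in> U_sub k \<Theta> \<inter> X" if "i < arity f" for i
  proof -
    have "A i \<subseteq> cube n" "chi n (A i) \<in> down \<Theta>"
      using A[OF that] S(1) Sn(2) by (auto simp: critical_def)
    then show ?thesis
      using X(1) Sn(1) hull_in_U_sub[OF X(2)] unfolding g_def hull_class_def by blast
  qed
  have gS: "app (g i) s \<longleftrightarrow> \<pi> s ! i" if "i < arity f" "s \<in> S" for i s
  proof -
    have "A i \<subseteq> class_hull X n (A i)" using A[OF that(1)] Sn(2) by (intro subset_hull) blast
    moreover have "class_hull X n (A i) \<inter> S \<subseteq> A i"
      using hull_inter_critical[OF X(2) S(1) A[OF that(1)]] .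
    ultimately show ?thesis using that(2) Sn(2) by (auto simp: g_def A_def)
  qed
  define gs where "gs = map g [0..<arity f]"
  define h where "h = compose n f gs"
  have "h \<in> U_sub k \<Theta>"
    unfolding h_def using gK
    by (intro subsetD[OF st] set_composeI[OF f]) (auto simp: gs_def g_def)
  moreover have "S \<subseteq> ones h"
  proof
    fix s assume s: "s \<in> S"
    have "map (\<lambda>g. app g s) gs = \<pi> s"
      using s gS \<pi>T[of s] T(1) by (intro nth_equalityI) (auto simp: gs_def ones_def)
    then have "app h s" using \<pi>T[of s] T(1) s Sn(2) by (auto simp: h_def compose_simps ones_def)
    then show "s \<in> ones h" using s Sn(2) by (auto simp: ones_def h_def compose_simps)
  qed
  ultimately have "chi n S \<in> down \<Theta>"
    using U_subD[of h k \<Theta> S] S(1) by (auto simp: critical_def h_def compose_simps)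
  with S(1) show False by (simp add: critical_def)
qed

end

section \<open>The classes\<close>

text \<open>The truth value \<open>e\<close> distinguishes a class from its dual under complementation of tuples:
  \<open>at_const e\<close> is \<open>\<Omega>\<^sub>*\<^sub>1\<close> or \<open>\<Omega>\<^sub>1\<^sub>*\<close>, and \<open>Mono e\<close> below consists of the monotone or the antitone
  functions. The constant tuple with entries \<open>e\<close> is the greatest one with respect to \<open>towards e\<close>.\<close>

definition at_const :: "bool \<Rightarrow> bfun set" where
  "at_const e = {f \<in> Omega. app f (replicate (arity f) e)}"

definition towards :: "bool \<Rightarrow> bool list \<Rightarrow> bool list \<Rightarrow> bool" where
  "towards e = list_all2 (\<lambda>u v. u = e \<longrightarrow> v = e)"

definition Mono :: "bool \<Rightarrow> bfun set" where
  "Mono e = {f \<in> Omega. \<forall>a b. towards e a b \<longrightarrow> app f a \<longrightarrow> app f b}"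

lemma at_const_eq: "at_const True = at_one Omega True" "at_const False = at_zero Omega True"
  by (auto simp: at_const_def at_one_def at_zero_def)

lemma towards_length: "towards e a b \<Longrightarrow> length a = length b"
  by (simp add: towards_def list_all2_lengthD)

lemma towards_True: "towards True a b \<longleftrightarrow> tuple_le a b"
  by (simp add: towards_def tuple_le_def le_bool_def list_all2_conv_all_nth)

lemma towards_False: "towards False a b \<longleftrightarrow> tuple_le b a"
  by (auto simp: towards_def tuple_le_def le_bool_def list_all2_conv_all_nth)

lemma towards_replicate: "length a = n \<Longrightarrow> towards e a (replicate n e)"
  by (simp add: towards_def list_all2_conv_all_nth)

lemma replicate_towards: "towards e (replicate n e) b \<longleftrightarrow> b = replicate n e"
  by (auto simp: towards_def list_all2_conv_all_nth list_eq_iff_nth_eq)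

lemma towards_reindex:
  "towards e a b \<Longrightarrow> \<forall>i<l. \<sigma> i < length a \<Longrightarrow> towards e (reindex l \<sigma> a) (reindex l \<sigma> b)"
  by (auto simp: towards_def list_all2_conv_all_nth reindex_def)

lemma Mono_True: "Mono True = Mon"
proof
  show "Mono True \<subseteq> Mon" by (auto simp: Mono_def Mon_def towards_True le_bool_def)
  have "app f b" if "f \<in> Mon" "tuple_le a b" "app f a" for f a b
  proof -
    have "f \<in> Omega" using that(1) by (simp add: Mon_def)
    then have "length a = arity f" using that(3) OmegaD(2) by blast
    moreover have "length b = length a"
      using that(2) by (simp add: tuple_le_def list_all2_lengthD)
    ultimately show ?thesis using MonD that by metis
  qed
  then show "Mon \<subseteq> Mono True"
    unfolding Mono_def towards_True Mon_def by blast
qed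

lemma Mono_False: "Mono False = NegMon"
proof
  show "Mono False \<subseteq> NegMon"
  proof
    fix f assume "f \<in> Mono False"
    then show "f \<in> NegMon"
      by (intro NegMonI) (auto simp: Mono_def towards_False)
  qed
  have "app f b" "f \<in> Omega" if "f \<in> NegMon" "tuple_le b a" "app f a" for f a b
  proof -
    show "f \<in> Omega" using that(1) by (auto simp: NegMon_def Mon_def neg_Omega)
    then have "length a = arity f" using that(3) OmegaD(2) by blast
    moreover have "length b = length a"
      using that(2) by (simp add: tuple_le_def list_all2_lengthD)
    ultimately show "app f b" using NegMonD that by metis
  qed
  moreover have "NegMon \<subseteq> Omega" by (auto simp: NegMon_def Mon_def neg_Omega)
  ultimately show "NegMon \<subseteq> Mono False"
    unfolding Mono_def towards_False by blast
qed

lemma MonoD: "f \<in> Mono e \<Longrightarrow> towards e a b \<Longrightarrow> app f a \<Longrightarrow> app f b"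
  unfolding Mono_def by blast

lemma class_cases:
  "at_const e \<in> {at_one Omega True, at_zero Omega True, Mon, NegMon, Reflexive}"
  "Mono e \<in> {at_one Omega True, at_zero Omega True, Mon, NegMon, Reflexive}"
  by (cases e; simp add: at_const_eq Mono_True Mono_False)+

lemma hull_class_classes: "hull_class (at_const e)" "hull_class (Mono e)" "hull_class Reflexive"
proof -
  show "hull_class (at_const e)"
    by (rule hull_class_of_meet[OF _ meet_majorants_classes[OF _ class_cases(1)]])
       (auto simp: at_const_def)
  show "hull_class (Mono e)"
    by (rule hull_class_of_meet[OF _ meet_majorants_classes[OF _ class_cases(2)]])
       (auto simp: Mono_def)
  show "hull_class Reflexive"
    by (rule hull_class_of_meet[OF _ meet_majorants_classes]) (auto simp: Reflexive_def)
qed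

lemma hull_class_Omega: "hull_class Omega"
  by (simp add: hull_class_def)

lemma Reflexive_iff: "f \<in> Reflexive \<longleftrightarrow> f \<in> Omega \<and> (\<forall>a. app f a \<longrightarrow> app f (map Not a))"
proof -
  have "map Not (map Not a) = a" for a by (simp add: comp_def)
  then have "(\<forall>a. app f a \<longrightarrow> app f (map Not a)) \<longleftrightarrow>
      (\<forall>a. length a = arity f \<longrightarrow> app f a = app f (map Not a))" if "f \<in> Omega"
    using OmegaD(2)[OF that] by metis
  then show ?thesis unfolding Reflexive_def by blast
qed

lemma minor_map_at_const:
  assumes "g \<in> at_const e" "1 \<le> n" "\<forall>i<arity g. \<sigma> i < n"
  shows "minor_map n \<sigma> g \<in> at_const e"
proof -
  have "reindex (arity g) \<sigma> (replicate n e) = replicate (arity g) e"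
    using assms(3) by (intro reindex_replicate) blast
  then show ?thesis
    using assms Omega_minor_map by (simp add: at_const_def minor_map_simps)
qed

lemma minor_map_Mono:
  assumes "g \<in> Mono e" "1 \<le> n" "\<forall>i<arity g. \<sigma> i < n"
  shows "minor_map n \<sigma> g \<in> Mono e"
  unfolding Mono_def
proof (intro CollectI conjI allI impI)
  show "minor_map n \<sigma> g \<in> Omega" using assms(2) by (rule Omega_minor_map)
  fix a b assume "towards e a b" "app (minor_map n \<sigma> g) a"
  then show "app (minor_map n \<sigma> g) b"
    using assms(3) MonoD[OF assms(1) towards_reindex[of e a b "arity g" \<sigma>]] towards_length[of e a b]
    by (simp add: minor_map_simps)
qed

lemma minor_map_Reflexive:
  assumes "g \<in> Reflexive" "1 \<le> n" "\<forall>i<arity g. \<sigma> i < n"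
  shows "minor_map n \<sigma> g \<in> Reflexive"
proof -
  have "reindex (arity g) \<sigma> (map Not a) = map Not (reindex (arity g) \<sigma> a)" if "length a = n" for a
    using assms(3) that by (simp add: reindex_def)
  then show ?thesis
    using assms(1,2) Omega_minor_map by (simp add: Reflexive_iff minor_map_simps)
qed

lemma hull_closed_classes:
  assumes "\<Theta> \<subseteq> Omega"
  shows "closed_under k (at_const e) \<Theta> \<Longrightarrow> hull_closed k (at_const e) \<Theta>"
    and "closed_under k (Mono e) \<Theta> \<Longrightarrow> hull_closed k (Mono e) \<Theta>"
    and "closed_under k Reflexive \<Theta> \<Longrightarrow> hull_closed k Reflexive \<Theta>"
proof -
  have O: "\<theta> \<in> Omega" if "\<theta> \<in> \<Theta>" for \<theta> using assms that by blast
  show "closed_under k (at_const e) \<Theta> \<Longrightarrow> hull_closed k (at_const e) \<Theta>"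
    by (erule hull_closed_of_closed_under[OF assms])
       (rule least_majorant_classes[OF O class_cases(1)] minor_map_at_const; assumption)+
  show "closed_under k (Mono e) \<Theta> \<Longrightarrow> hull_closed k (Mono e) \<Theta>"
    by (erule hull_closed_of_closed_under[OF assms])
       (rule least_majorant_classes[OF O class_cases(2)] minor_map_Mono; assumption)+
  have R: "Reflexive \<in> {at_one Omega True, at_zero Omega True, Mon, NegMon, Reflexive}" by simp
  show "closed_under k Reflexive \<Theta> \<Longrightarrow> hull_closed k Reflexive \<Theta>"
    by (erule hull_closed_of_closed_under[OF assms])
       (rule least_majorant_classes[OF O R] minor_map_Reflexive; assumption)+
qed

lemma hull_closed_Omega:
  assumes "\<Theta> \<subseteq> Omega"
  shows "hull_closed k Omega \<Theta>"
  unfolding hull_closed_def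
proof (intro allI impI)
  fix n :: nat and A T
  assume n: "1 \<le> n" "A \<subseteq> cube n" "chi n A \<in> down \<Theta>" "T \<subseteq> class_hull Omega n A"
  have "class_hull Omega n A \<subseteq> A"
    using hull_least[of "chi n A" Omega n A] n(1,2) by auto
  then show "chi n T \<in> down \<Theta>" using chi_subset_down[OF assms n(3,1,2)] n(4) by blast
qed

lemma const_in_hull:
  shows "replicate n e \<in> class_hull (at_const e) n A"
    and "A \<noteq> {} \<Longrightarrow> A \<subseteq> cube n \<Longrightarrow> replicate n e \<in> class_hull (Mono e) n A"
    and "replicate n e \<in> class_hull Reflexive n {replicate n (\<not> e)}"
proof -
  show "replicate n e \<in> class_hull (at_const e) n A"
    by (auto simp: class_hull_def at_const_def)
  show "replicate n e \<in> class_hull (Mono e) n A" if A: "A \<noteq> {}" "A \<subseteq> cube n"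
  proof -
    obtain b where "b \<in> A" "length b = n" using A by blast
    then show ?thesis
      using MonoD[OF _ towards_replicate[of b n e]] by (auto simp: class_hull_def)
  qed
  show "replicate n e \<in> class_hull Reflexive n {replicate n (\<not> e)}"
    by (fastforce simp: class_hull_def Reflexive_iff)
qed

lemma compose_at_const:
  assumes "app f (replicate (arity f) True)" "length gs = arity f"
    and "\<And>g. g \<in> set gs \<Longrightarrow> app g (replicate m e)"
  shows "app (compose m f gs) (replicate m e)"
proof -
  have "map (\<lambda>g. app g (replicate m e)) gs = replicate (arity f) True"
    using assms(2,3) by (intro nth_equalityI) auto
  then show ?thesis using assms(1) by (simp add: compose_simps)
qed

lemma compose_mono:
  assumes "f \<in> Mon" "length gs = arity f" "\<And>g. g \<in> set gs \<Longrightarrow> app g a \<Longrightarrow> app g b" "length b = m"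
    and "app (compose m f gs) a"
  shows "app (compose m f gs) b"
proof -
  have "tuple_le (map (\<lambda>g. app g a) gs) (map (\<lambda>g. app g b) gs)"
    using assms(3) by (auto simp: tuple_le_def le_bool_def list_all2_conv_all_nth)
  from MonD[OF assms(1) _ _ this] show ?thesis
    using assms(2,4,5) by (simp add: compose_simps)
qed


section \<open>Stabilizers of the individual classes\<close>

lemma at_both_UI:
  assumes "1 \<le> k" "C \<subseteq> V" "V \<subseteq> U k" "\<And>f. f \<in> C \<Longrightarrow> app f (replicate (arity f) True)"
  shows "C \<subseteq> at_both V False True"
proof
  fix f assume f: "f \<in> C"
  with assms(2,3) have "f \<in> V" "f \<in> U k" by blast+
  then show "f \<in> at_both V False True"
    using U_const_False[OF assms(1)] assms(4)[OF f] by (simp add: at_both_def at_zero_def at_one_def)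
qed

context large_critical_sets
begin

lemma k1: "1 \<le> k"
  using small_le_k[of 1] by (simp add: one_enat_def)

text \<open>The point is any element of a critical set with at least two elements.\<close>

lemma ex_point:
  assumes "hull_closed k X \<Theta>"
  shows "\<exists>n x. 1 \<le> n \<and> length x = n \<and> chi n {x} \<in> down \<Theta> \<and> chi n {} \<in> down \<Theta> \<and> x \<notin> class_hull X n {}"
proof -
  obtain n S where S: "critical k \<Theta> n S" "2 \<le> card S"
    using ex_critical_ge[of 0] small_le_k[of 0] by auto
  then obtain x where x: "x \<in> S" by fastforce
  have "{x} \<subset> S" using S(2) x by (auto simp: psubset_eq)
  moreover have "{} \<subset> S" using x by blast
  ultimately show ?thesis
    using S(1) x hull_inter_critical[OF assms S(1), of "{}"]
    by (intro exI[of _ n] exI[of _ x]) (auto simp: critical_def)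
qed

lemma hull_in_class:
  assumes "hull_class X" "hull_closed k X \<Theta>" "1 \<le> n" "A \<subseteq> cube n" "chi n A \<in> down \<Theta>"
  shows "chi n (class_hull X n A) \<in> U_sub k \<Theta> \<inter> X"
  using assms hull_in_U_sub unfolding hull_class_def by blast

lemma stabilizer_U_sub:
  assumes C: "C \<subseteq> Omega"
  shows "set_compose C (U_sub k \<Theta>) \<subseteq> U_sub k \<Theta> \<longleftrightarrow> C \<subseteq> U k"
proof
  assume "set_compose C (U_sub k \<Theta>) \<subseteq> U_sub k \<Theta>"
  then have "set_compose C (U_sub k \<Theta> \<inter> Omega) \<subseteq> U_sub k \<Theta>"
    using set_compose_mono[of "U_sub k \<Theta> \<inter> Omega" "U_sub k \<Theta>" C] by blast
  then show "C \<subseteq> U k"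
    by (rule stabilizer_subset_U[OF C hull_class_Omega hull_closed_Omega[OF Theta_Omega]])
next
  assume "C \<subseteq> U k"
  then show "set_compose C (U_sub k \<Theta>) \<subseteq> U_sub k \<Theta>"
    unfolding set_compose_subset_iff by (auto intro!: compose_U_sub)
qed

lemma stabilizer_at_const:
  assumes C: "C \<subseteq> Omega" and X: "hull_closed k (at_const e) \<Theta>"
    and K: "K = U_sub k \<Theta> \<inter> at_const e"
  shows "set_compose C K \<subseteq> K \<longleftrightarrow> C \<subseteq> at_both (U k) False True"
proof
  assume st: "set_compose C K \<subseteq> K"
  have "C \<subseteq> U k"
    by (rule stabilizer_subset_U[OF C hull_class_classes(1) X]) (use st K in blast)
  obtain n where n: "1 \<le> n" "chi n {} \<in> down \<Theta>" using ex_point[OF X] by blast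
  have g: "chi n (class_hull (at_const e) n {}) \<in> K"
    using hull_in_class[OF hull_class_classes(1) X n(1) _ n(2)] K by simp
  show "C \<subseteq> at_both (U k) False True"
    by (rule at_both_UI[OF k1 \<open>C \<subseteq> U k\<close> order_refl stabilizer_const_True[OF st g]])
       (auto simp: K at_const_def)
next
  assume CU: "C \<subseteq> at_both (U k) False True"
  show "set_compose C K \<subseteq> K"
    unfolding set_compose_subset_iff
  proof (intro allI impI)
    fix m f gs
    assume f: "f \<in> C" and gs: "length gs = arity f" "set gs \<subseteq> K" "\<forall>g\<in>set gs. arity g = m"
    let ?h = "compose m f gs"
    have "f \<in> U k" "app f (replicate (arity f) True)"
      using f CU by (auto simp: at_both_def at_zero_def at_one_def)
    moreover have "app g (replicate m e)" if "g \<in> set gs" for g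
      using that gs(2,3) by (auto simp: K at_const_def)
    ultimately have "?h \<in> U_sub k \<Theta>" "app ?h (replicate m e)"
      using compose_U_sub[of f k gs \<Theta> m] compose_at_const gs K by auto
    then show "?h \<in> K" by (simp add: K at_const_def U_sub_def compose_simps)
  qed
qed

text \<open>With the constant \<open>0\<close> available, the values at a suitable \<open>x\<close> and at the constant tuple \<open>e\<close>
  form the order relation: the pairs \<open>00\<close>, \<open>01\<close> and \<open>11\<close> come from the zero function and from the
  hulls of the empty set and of \<open>{x}\<close>. Conversely, a monotone combination that vanishes at the
  constant tuple \<open>e\<close>, where all the inner functions are maximal, vanishes everywhere.\<close>

lemma stabilizer_at_const_Const0:
  assumes C: "C \<subseteq> Omega" and X: "hull_closed k (at_const e) \<Theta>"
    and K: "K = U_sub k \<Theta> \<inter> (at_const e \<union> Const0)"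
  shows "set_compose C K \<subseteq> K \<longleftrightarrow> C \<subseteq> MU k"
proof
  assume st: "set_compose C K \<subseteq> K"
  have "set_compose C (U_sub k \<Theta> \<inter> at_const e) \<subseteq> set_compose C K"
    by (rule set_compose_mono) (auto simp: K)
  then have CU: "C \<subseteq> U k"
    by (intro stabilizer_subset_U[OF C hull_class_classes(1) X]) (use st K in blast)
  obtain n x where n: "1 \<le> n" "length x = n" "chi n {x} \<in> down \<Theta>" "chi n {} \<in> down \<Theta>"
      "x \<notin> class_hull (at_const e) n {}"
    using ex_point[OF X] by blast
  let ?H = "\<lambda>A. chi n (class_hull (at_const e) n A)" and ?y = "replicate n e"
  have H: "?H {} \<in> K" "?H {x} \<in> K"
    using hull_in_class[OF hull_class_classes(1) X n(1)] n(2-4) K by auto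
  have Z: "chi n {} \<in> K"
    using n(1,4) by (simp add: K U_sub_def ones_chi Const0_def)
  have "C \<subseteq> Mon"
  proof (rule stabilizer_monotone[OF C st, where x = x and y = ?y and m = n and
        ?G0.0 = "chi n {}" and ?G1.0 = "?H {}" and ?G2.0 = "?H {x}"])
    fix h assume "h \<in> K" "arity h = n" "app h x"
    then show "app h ?y" using n(2) by (auto simp: K at_const_def Const0_def)
  qed (use n H Z const_in_hull(1) subset_hull[of "{x}" n "at_const e"] in auto)
  with CU show "C \<subseteq> MU k" by (simp add: MU_def)
next
  assume CM: "C \<subseteq> MU k"
  show "set_compose C K \<subseteq> K"
    unfolding set_compose_subset_iff
  proof (intro allI impI)
    fix m f gs
    assume f: "f \<in> C" and gs: "length gs = arity f" "set gs \<subseteq> K" "\<forall>g\<in>set gs. arity g = m"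
    let ?h = "compose m f gs"
    have f': "f \<in> U k" "f \<in> Mon" using f CM by (auto simp: MU_def)
    then have h: "?h \<in> U_sub k \<Theta>" using compose_U_sub gs K by blast
    then have hO: "?h \<in> Omega" by (simp add: U_sub_def)
    have "app g (replicate m e)" if "g \<in> set gs" "app g a" "length a = m" for g a
      using that gs(2,3) by (auto simp: K at_const_def Const0_def)
    then have "app ?h (replicate m e)" if "app ?h a" "length a = m" for a
      using compose_mono[OF f'(2) gs(1), of a "replicate m e" m] that by auto
    then have "?h \<in> at_const e \<union> Const0"
      using hO by (auto simp: at_const_def Const0_def compose_simps(1))
    with h show "?h \<in> K" by (simp add: K)
  qed
qed

lemma compose_Mono:
  assumes "f \<in> MU k" "length gs = arity f" "set gs \<subseteq> U_sub k \<Theta> \<inter> Mono e" "\<forall>g\<in>set gs. arity g = m"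
  shows "compose m f gs \<in> U_sub k \<Theta> \<inter> Mono e"
proof -
  let ?h = "compose m f gs"
  have f: "f \<in> U k" "f \<in> Mon" using assms(1) by (auto simp: MU_def)
  then have h: "?h \<in> U_sub k \<Theta>" using compose_U_sub assms(2-4) by blast
  have "app ?h b" if ab: "towards e a b" "app ?h a" for a b
  proof (rule compose_mono[OF f(2) assms(2) _ _ ab(2)])
    show "length b = m" using ab towards_length by (fastforce simp: compose_simps)
    show "app g b" if "g \<in> set gs" "app g a" for g
      using that assms(3) ab(1) MonoD by blast
  qed
  with h show ?thesis by (auto simp: Mono_def U_sub_def)
qed

text \<open>The hulls in \<open>Mono e\<close> and in its subclass of functions that are \<open>1\<close> at the constant tuple \<open>e\<close>
  differ only for the empty set, whose hull in the latter consists of that tuple alone. But that tuple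
  also lies in the hull in \<open>Mono e\<close> of any one point, so the closure condition covers it.\<close>

lemma hull_closed_Mono_at_const:
  assumes M: "hull_closed k (Mono e) \<Theta>"
  shows "hull_closed k (Mono e \<inter> at_const e) \<Theta>"
  unfolding hull_closed_def
proof (intro allI impI)
  let ?X = "Mono e \<inter> at_const e"
  fix n :: nat and A T
  assume n: "1 \<le> n" "A \<subseteq> cube n" "chi n A \<in> down \<Theta>" "T \<subseteq> class_hull ?X n A" "enat (card T) \<le> k"
  show "chi n T \<in> down \<Theta>"
  proof (cases "A = {}")
    case True
    let ?e = "replicate n e"
    have "chi n {?e} \<in> ?X"
      using n(1) by (auto simp: Mono_def at_const_def replicate_towards)
    then have "class_hull ?X n A \<subseteq> {?e}"
      using hull_least[of "chi n {?e}" ?X n A] True by auto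
    then have T: "T \<subseteq> {?e}" using n(4) by blast
    obtain m x where m: "1 \<le> m" "length x = m" "chi m {x} \<in> down \<Theta>" using ex_point[OF M] by blast
    have "replicate m e \<in> class_hull (Mono e) m {x}" using const_in_hull(2)[of "{x}"] m(2) by simp
    then have "chi m {replicate m e} \<in> down \<Theta>"
      using m(2) by (intro hull_closedD[OF M m(1) _ m(3)]) (auto intro: small_le_k)
    then have "chi n {?e} \<in> down \<Theta>"
      by (rule chi_reindex_down[OF Theta_Omega, where \<tau> = "\<lambda>_. 0"])
        (use m(1) n(1) in \<open>auto simp: reindex_const\<close>)
    then show ?thesis using chi_subset_down[OF Theta_Omega _ n(1) _ T] by simp
  next
    case False
    then obtain b where b: "b \<in> A" "length b = n" using n(2) by blast
    have "g \<in> at_const e" if "g \<in> Mono e" "arity g = n" "\<forall>a\<in>A. app g a" for g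
      using that b MonoD[OF that(1) towards_replicate[of b n e]]
      by (auto simp: at_const_def Mono_def)
    then have "class_hull ?X n A \<subseteq> class_hull (Mono e) n A"
      unfolding class_hull_def by blast
    then show ?thesis using hull_closedD[OF M n(1-3) _ n(5)] n(4) by blast
  qed
qed

text \<open>A point \<open>x\<close> other than the constant tuple \<open>e\<close> is extended by one coordinate to the pair
  \<open>x(1-e)\<close>, \<open>xe\<close>, neither of which is the constant tuple \<open>e\<close>; hence the three patterns needed for
  monotonicity occur at this pair even among functions that are \<open>1\<close> at the constant tuple \<open>e\<close>.\<close>

lemma stabilizer_Mono_subset_MU:
  assumes C: "C \<subseteq> Omega" and M: "hull_closed k (Mono e) \<Theta>"
    and K: "U_sub k \<Theta> \<inter> (Mono e \<inter> at_const e) \<subseteq> K" "K \<subseteq> U_sub k \<Theta> \<inter> Mono e"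
    and st: "set_compose C K \<subseteq> K"
  shows "C \<subseteq> MU k"
proof -
  let ?X = "Mono e \<inter> at_const e"
  have X: "hull_class ?X" "hull_closed k ?X \<Theta>"
    using hull_class_inter hull_class_classes hull_closed_Mono_at_const[OF M] by blast+
  have "set_compose C (U_sub k \<Theta> \<inter> ?X) \<subseteq> U_sub k \<Theta>"
    using set_compose_mono[OF K(1), of C] st K(2) by blast
  then have CU: "C \<subseteq> U k" by (rule stabilizer_subset_U[OF C X])
  obtain n x where n: "1 \<le> n" "length x = n" "chi n {x} \<in> down \<Theta>" "chi n {} \<in> down \<Theta>"
      "x \<notin> class_hull ?X n {}"
    using ex_point[OF X(2)] by blast
  have "replicate n e \<in> class_hull ?X n {}" by (auto simp: class_hull_def at_const_def)
  with n(5) have xe: "x \<noteq> replicate n e" by blast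
  let ?m = "Suc n" and ?x = "x @ [\<not> e]" and ?y = "x @ [e]"
  have red: "reindex n (\<lambda>i. i) (x @ [c]) = x" for c
    using n(2) by (intro nth_equalityI) (auto simp: reindex_def nth_append)
  have down: "chi ?m {x @ [c]} \<in> down \<Theta>" for c
    using n(1,2) by (intro chi_reindex_down[OF Theta_Omega n(3), where \<tau> = "\<lambda>i. i"]) (auto simp: red)
  then have down0: "chi ?m {} \<in> down \<Theta>"
    using chi_subset_down[OF Theta_Omega down[of e], of "{}"] n(2) by simp
  let ?H = "\<lambda>A. chi ?m (class_hull ?X ?m A)"
  have HK: "?H A \<in> K" if "A \<subseteq> cube ?m" "chi ?m A \<in> down \<Theta>" for A
    using hull_in_class[OF X _ that] K(1) by auto
  have H: "?H {} \<in> K" "?H {?y} \<in> K" "?H {?x} \<in> K"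
    using HK[OF _ down0] HK[OF _ down[of e]] HK[OF _ down[of "\<not> e"]] n(2) by simp_all
  have xy: "towards e ?x ?y"
    by (simp add: towards_def list_all2_conv_all_nth nth_append)
  have ext: "x @ [c] \<noteq> replicate ?m e" for c
    using xe n(2) by (auto simp: replicate_append_same[symmetric])
  have "chi ?m {replicate ?m e} \<in> ?X"
    by (auto simp: Mono_def at_const_def replicate_towards simp del: replicate_Suc)
  from hull_least[OF this, of ?m "{}"] have H0: "\<not> app (?H {}) (x @ [c])" for c
    using ext[of c] by auto
  have "chi ?m {z. z ! n = e} \<in> ?X"
    by (auto simp: Mono_def at_const_def towards_def list_all2_conv_all_nth simp del: replicate_Suc)
  from hull_least[OF this, of ?m "{?y}" ?x] have H1: "\<not> app (?H {?y}) ?x"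
    using n(2) by (auto simp: nth_append)
  have sub: "app (?H {x @ [c]}) (x @ [c])" for c
    using subset_hull[of "{x @ [c]}" ?m ?X] n(2) by auto
  have le: "app h ?y" if "h \<in> K" "app h ?x" for h
    using that K(2) MonoD[OF _ xy] by blast
  have "C \<subseteq> Mon"
    by (rule stabilizer_monotone[OF C st, where x = ?x and y = ?y and m = ?m and
          ?G0.0 = "?H {}" and ?G1.0 = "?H {?y}" and ?G2.0 = "?H {?x}"])
       (use n(2) H H0 H1 sub le in \<open>simp_all del: chi_simps(2)\<close>)
  with CU show ?thesis by (simp add: MU_def)
qed

lemma stabilizer_Mono:
  assumes C: "C \<subseteq> Omega" and M: "hull_closed k (Mono e) \<Theta>" and K: "K = U_sub k \<Theta> \<inter> Mono e"
  shows "set_compose C K \<subseteq> K \<longleftrightarrow> C \<subseteq> MU k"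
proof
  assume "set_compose C K \<subseteq> K"
  then show "C \<subseteq> MU k" by (intro stabilizer_Mono_subset_MU[OF C M, of K]) (auto simp: K)
next
  assume "C \<subseteq> MU k"
  then show "set_compose C K \<subseteq> K"
    unfolding set_compose_subset_iff K using compose_Mono by blast
qed

lemma stabilizer_Mono_at_const:
  assumes C: "C \<subseteq> Omega" and M: "hull_closed k (Mono e) \<Theta>"
    and K: "K = U_sub k \<Theta> \<inter> (Mono e \<inter> at_const e)"
  shows "set_compose C K \<subseteq> K \<longleftrightarrow> C \<subseteq> at_both (MU k) False True"
proof
  let ?X = "Mono e \<inter> at_const e"
  assume st: "set_compose C K \<subseteq> K"
  then have CM: "C \<subseteq> MU k" by (intro stabilizer_Mono_subset_MU[OF C M, of K]) (auto simp: K)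
  have X: "hull_class ?X" "hull_closed k ?X \<Theta>"
    using hull_class_inter hull_class_classes hull_closed_Mono_at_const[OF M] by blast+
  obtain n where n: "1 \<le> n" "chi n {} \<in> down \<Theta>" using ex_point[OF M] by blast
  have g: "chi n (class_hull ?X n {}) \<in> K"
    using hull_in_class[OF X n(1) _ n(2)] K by simp
  show "C \<subseteq> at_both (MU k) False True"
    by (rule at_both_UI[OF k1 CM _ stabilizer_const_True[OF st g]])
       (auto simp: K at_const_def MU_def)
next
  assume CM: "C \<subseteq> at_both (MU k) False True"
  show "set_compose C K \<subseteq> K"
    unfolding set_compose_subset_iff
  proof (intro allI impI)
    fix m f gs
    assume f: "f \<in> C" and gs: "length gs = arity f" "set gs \<subseteq> K" "\<forall>g\<in>set gs. arity g = m"
    let ?h = "compose m f gs"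
    have f': "f \<in> MU k" "app f (replicate (arity f) True)"
      using f CM by (auto simp: at_both_def at_zero_def at_one_def)
    have h: "?h \<in> U_sub k \<Theta> \<inter> Mono e" using gs K by (intro compose_Mono f') auto
    have "app g (replicate m e)" if "g \<in> set gs" for g
      using that gs(2,3) by (auto simp: K at_const_def)
    then have "app ?h (replicate m e)" using compose_at_const f' gs(1) by blast
    then show "?h \<in> K" using h by (simp add: K at_const_def Mono_def compose_simps)
  qed
qed

lemma stabilizer_Reflexive:
  assumes C: "C \<subseteq> Omega" and R: "hull_closed k Reflexive \<Theta>" and K: "K = U_sub k \<Theta> \<inter> Reflexive"
  shows "set_compose C K \<subseteq> K \<longleftrightarrow> C \<subseteq> U k"
proof
  assume "set_compose C K \<subseteq> K"
  then show "C \<subseteq> U k"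
    by (intro stabilizer_subset_U[OF C hull_class_classes(3) R]) (auto simp: K)
next
  assume CU: "C \<subseteq> U k"
  show "set_compose C K \<subseteq> K"
    unfolding set_compose_subset_iff
  proof (intro allI impI)
    fix m f gs
    assume f: "f \<in> C" and gs: "length gs = arity f" "set gs \<subseteq> K" "\<forall>g\<in>set gs. arity g = m"
    let ?h = "compose m f gs"
    have h: "?h \<in> U_sub k \<Theta>" using f CU gs K by (intro compose_U_sub) auto
    have "map (\<lambda>g. app g a) gs = map (\<lambda>g. app g (map Not a)) gs" if "length a = m" for a
    proof (rule map_cong[OF refl])
      fix g assume "g \<in> set gs"
      then have "g \<in> Reflexive" "length a = arity g" using gs K that by auto
      then show "app g a = app g (map Not a)" unfolding Reflexive_def by blast
    qed
    then have "app ?h (map Not a)" if "app ?h a" for a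
      using that by (metis compose_simps(2) length_map)
    then have "?h \<in> Reflexive"
      using h by (simp add: Reflexive_iff U_sub_def)
    with h show "?h \<in> K" by (simp add: K)
  qed
qed

end

theorem proposition7p2p2:
  fixes k :: enat and \<Theta> C :: "bfun set"
  assumes "2 \<le> k"
    and "\<Theta> \<subseteq> Omega_le k"
    and "\<Theta> \<noteq> {}"
    and "k = (LEAST l. \<exists>\<Theta>'. \<Theta>' \<subseteq> Omega_le l \<and> U_sub k \<Theta> = U_sub l \<Theta>')"
    and "clone C"
  shows
    "(set_compose C (U_sub k \<Theta>) \<subseteq> U_sub k \<Theta> \<longleftrightarrow> C \<subseteq> U k)
   \<and> (closed_under k (at_one Omega True) \<Theta> \<longrightarrow>
        (\<forall>K. K = U_sub k \<Theta> \<inter> (at_both Omega False True \<union> Const0) \<longrightarrow>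
             (set_compose C K \<subseteq> K \<longleftrightarrow> C \<subseteq> MU k))
      \<and> (\<forall>K. K = U_sub k \<Theta> \<inter> at_both Omega False True \<longrightarrow>
             (set_compose C K \<subseteq> K \<longleftrightarrow> C \<subseteq> at_both (U k) False True)))
   \<and> (closed_under k (at_zero Omega True) \<Theta> \<longrightarrow>
        (\<forall>K. K = U_sub k \<Theta> \<inter> (at_both Omega True False \<union> Const0) \<longrightarrow>
             (set_compose C K \<subseteq> K \<longleftrightarrow> C \<subseteq> MU k))
      \<and> (\<forall>K. K = U_sub k \<Theta> \<inter> at_both Omega True False \<longrightarrow>
             (set_compose C K \<subseteq> K \<longleftrightarrow> C \<subseteq> at_both (U k) False True)))
   \<and> (closed_under k Mon \<Theta> \<longrightarrow>
        (\<forall>K. K = U_sub k \<Theta> \<inter> at_zero Mon False \<longrightarrow>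
             (set_compose C K \<subseteq> K \<longleftrightarrow> C \<subseteq> MU k))
      \<and> (\<forall>K. K = U_sub k \<Theta> \<inter> at_both Mon False True \<longrightarrow>
             (set_compose C K \<subseteq> K \<longleftrightarrow> C \<subseteq> at_both (MU k) False True)))
   \<and> (closed_under k NegMon \<Theta> \<longrightarrow>
        (\<forall>K. K = U_sub k \<Theta> \<inter> at_one NegMon False \<longrightarrow>
             (set_compose C K \<subseteq> K \<longleftrightarrow> C \<subseteq> MU k))
      \<and> (\<forall>K. K = U_sub k \<Theta> \<inter> at_both NegMon True False \<longrightarrow>
             (set_compose C K \<subseteq> K \<longleftrightarrow> C \<subseteq> at_both (MU k) False True)))
   \<and> (closed_under k Reflexive \<Theta> \<longrightarrow>
        (\<forall>K. K = U_sub k \<Theta> \<inter> at_both Reflexive False False \<longrightarrow>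
             (set_compose C K \<subseteq> K \<longleftrightarrow> C \<subseteq> U k)))"
proof -
  have \<Theta>: "\<Theta> \<subseteq> Omega" using assms(2) by (auto simp: Omega_le_def)
  have C: "C \<subseteq> Omega" using assms(5) by (simp add: clone_def)
  have "\<not> (\<exists>\<Theta>'. \<Theta>' \<subseteq> Omega_le l \<and> U_sub k \<Theta> = U_sub l \<Theta>')" if "l < k" for l
    by (rule not_less_Least[OF less_le_trans[OF that eq_refl[OF assms(4)]]])
  then interpret large_critical_sets k \<Theta>
    using assms(1) \<Theta> ex_large_critical[OF \<Theta>] by unfold_locales blast+
  note hc = hull_closed_classes[OF \<Theta>, of k]

  \<comment> \<open>The values at the constant tuples that are prescribed to be \<open>0\<close> are \<open>0\<close> on all of \<open>U_sub k \<Theta>\<close>,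
    so the sets \<open>K\<close> are intersections of \<open>U_sub k \<Theta>\<close> with the classes treated above.\<close>
  have zero: "\<not> app g (replicate (arity g) (\<not> e))"
    if "hull_closed k (at_const e) \<Theta> \<or> hull_closed k (Mono e) \<Theta> \<or> hull_closed k Reflexive \<Theta>"
      and "g \<in> U_sub k \<Theta>" for g e
    using that(1)
  proof (elim disjE)
    assume "hull_closed k (at_const e) \<Theta>"
    from U_sub_const_False[OF this const_in_hull(1) that(2)] show ?thesis .
  next
    assume "hull_closed k (Mono e) \<Theta>"
    from U_sub_const_False[OF this const_in_hull(2) that(2)] show ?thesis by simp
  next
    assume "hull_closed k Reflexive \<Theta>"
    from U_sub_const_False[OF this const_in_hull(3) that(2)] show ?thesis .
  qed
  have O: "U_sub k \<Theta> \<subseteq> Omega" by (auto simp: U_sub_def)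
  have one: "U_sub k \<Theta> \<inter> (at_both Omega False True \<union> Const0) = U_sub k \<Theta> \<inter> (at_const True \<union> Const0)"
      "U_sub k \<Theta> \<inter> at_both Omega False True = U_sub k \<Theta> \<inter> at_const True"
    if "hull_closed k (at_const True) \<Theta>"
    using zero[of True] that by (auto simp: at_both_def at_zero_def at_one_def at_const_def)
  have zer: "U_sub k \<Theta> \<inter> (at_both Omega True False \<union> Const0) = U_sub k \<Theta> \<inter> (at_const False \<union> Const0)"
      "U_sub k \<Theta> \<inter> at_both Omega True False = U_sub k \<Theta> \<inter> at_const False"
    if "hull_closed k (at_const False) \<Theta>"
    using zero[of False] that by (auto simp: at_both_def at_zero_def at_one_def at_const_def)
  have mon: "U_sub k \<Theta> \<inter> at_zero (Mono True) False = U_sub k \<Theta> \<inter> Mono True"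
      "U_sub k \<Theta> \<inter> at_both (Mono True) False True = U_sub k \<Theta> \<inter> (Mono True \<inter> at_const True)"
    if "hull_closed k (Mono True) \<Theta>"
    using zero[of True] that O
    by (auto simp: at_both_def at_zero_def at_one_def at_const_def)
  have neg: "U_sub k \<Theta> \<inter> at_one (Mono False) False = U_sub k \<Theta> \<inter> Mono False"
      "U_sub k \<Theta> \<inter> at_both (Mono False) True False = U_sub k \<Theta> \<inter> (Mono False \<inter> at_const False)"
    if "hull_closed k (Mono False) \<Theta>"
    using zero[of False] that O
    by (auto simp: at_both_def at_zero_def at_one_def at_const_def)
  have ref: "U_sub k \<Theta> \<inter> at_both Reflexive False False = U_sub k \<Theta> \<inter> Reflexive"
    if "hull_closed k Reflexive \<Theta>"
    using zero[of True] zero[of False] that by (auto simp: at_both_def at_zero_def at_one_def)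

  show ?thesis
    unfolding at_const_eq[symmetric] Mono_True[symmetric] Mono_False[symmetric]
  proof (intro conjI impI allI)
    show "set_compose C (U_sub k \<Theta>) \<subseteq> U_sub k \<Theta> \<longleftrightarrow> C \<subseteq> U k" by (rule stabilizer_U_sub[OF C])
  qed (use hc stabilizer_at_const_Const0[OF C _ refl] stabilizer_at_const[OF C _ refl]
      stabilizer_Mono[OF C _ refl] stabilizer_Mono_at_const[OF C _ refl] stabilizer_Reflexive[OF C _ refl]
      one zer mon neg ref in simp_all)
qed

end
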